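(* The system $\mathsf Z_2^{\omega}+\mathsf{IND}_0$ does not prove $\mathsf{BCT}_{[0,1]}$, where $\mathsf{BCT}_{[0,1]}$ is the statement: if $(O_n)_{n\in\mathbb N}$ is a decreasing sequence of dense open sets of reals in $[0,1]$, then $\bigcap_{n\in\mathbb N}O_n$ is non-empty.
   Context: Formal setting. $\mathsf{RCA}_0^{\omega}$ is Kohlenbach's base theory of higher-order Reverse Mathematics: a classical theory in the language of all finite types (type $0$ is the natural numbers, $\sigma\to\tau$ is the type of maps from type $\sigma$ to type $\tau$ objects, $1:=0\to 0$, $n+1:=n\to 0$; equality at higher types is defined pointwise from equality at type $0$), with axioms: ordered semi-ring axioms for $0,1,<,+,\times$; combinator axioms giving $\lambda$-abstraction; primitive recursion $\mathbf R_0(f,m,0)=m$, $\mathbf R_0(f,m,n+1)=f(n,\mathbf R_0(f,m,n))$ for number-valued $f$ on numbers; extensionality $x=_\rho y\to\varphi(x)=_\tau\varphi(y)$ at all types; induction for quantifier-free formulas (parameters of any type allowed); and $\mathsf{QF\text{-}AC}^{1,0}$, where $\mathsf{QF\text{-}AC}^{\sigma,\tau}$ is the schema $(\forall x^\sigma)(\exists y^\tau)A(x,y)\to(\exists Y^{\sigma\to\tau})(\forall x^\sigma)A(x,Y(x))$ for quantifier-free $A$. Reals are fast-converging Cauchy sequences of rationals ($|q_n-q_{n+i}|<2^{-n}$) with the usual $=_{\mathbb R},<_{\mathbb R}$; functions on reals are type $1\to1$ objects respecting $=_{\mathbb R}$. A set of reals is given by its characteristic function (a sequence of sets by a function of a real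 and a number). $O$ is open if for each $x\in O$ some ball $B(x,2^{-k})$ is contained in $O$ (no further representation is given), relative to $[0,1]$ for subsets of $[0,1]$. For $k\ge1$, $(\mathsf S_k^2)$ is the axiom stating that there is a functional $\mathsf S_k^2:\mathbb N^{\mathbb N}\to\{0,1\}$ deciding the truth of $\Sigma_k^1$-formulas of second-order arithmetic (with parameters in $\mathbb N$ and $\mathbb N^{\mathbb N}$ only); for $k=1$ this is the Suslin functional: $\mathsf S^2(f)=0\leftrightarrow(\exists g\in\mathbb N^{\mathbb N})(\forall n)(f(\overline gn)=0)$ for all $f\in\mathbb N^{\mathbb N}$, where $\overline gn$ codes $\langle g(0),\dots,g(n-1)\rangle$. $\mathsf Z_2^{\omega}$ is $\mathsf{RCA}_0^{\omega}$ together with the axioms $(\mathsf S_k^2)$ for all $k$. $\mathsf{IND}_0$: let $Y^2$ be such that for every $n\in\mathbb N$ there is at most one $f\in2^{\mathbb N}$ with $Y(f,n)=0$; then for every $k\in\mathbb N$ there is a finite sequence $w$ of length $k$ of elements of $\mathbb N^{\mathbb N}$ such that for all $m<k$: $(w(m)\in2^{\mathbb N}\wedge Y(w(m),m)=0)\leftrightarrow(\exists f\in2^{\mathbb N})(Y(f,m)=0)$. *)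

theory Defs
  imports Main
begin

section \<open>The language of all finite types\<close>

datatype ty = T0 | Fn ty ty  (infixr "\<rightarrowtail>" 70)

abbreviation T1 :: ty where "T1 \<equiv> T0 \<rightarrowtail> T0"
abbreviation T2 :: ty where "T2 \<equiv> T1 \<rightarrowtail> T0"

text \<open>A variable carries its type, so \<open>(0, T0)\<close> and \<open>(0, T1)\<close> are different variables.\<close>

type_synonym var = "nat \<times> ty"

datatype tm =
    Var var
  | App tm tm  (infixl "\<cdot>" 100)
  | Zero | One | Plus | Times
  | Kc ty ty        \<comment> \<open>combinator \<open>\<Pi>\<close>\<close>
  | Sc ty ty ty     \<comment> \<open>combinator \<open>\<Sigma>\<close>\<close>
  | Rc              \<comment> \<open>recursor \<open>R\<^sub>0\<close>\<close>

text \<open>\<open>type_of\<close> is meaningful for terms satisfying \<open>wt\<close> only.\<close>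

fun cod :: "ty \<Rightarrow> ty" where
  "cod T0 = T0"
| "cod (\<sigma> \<rightarrowtail> \<tau>) = \<tau>"

primrec type_of :: "tm \<Rightarrow> ty" where
  "type_of (Var x) = snd x"
| "type_of (s \<cdot> t) = cod (type_of s)"
| "type_of Zero = T0"
| "type_of One = T0"
| "type_of Plus = T0 \<rightarrowtail> T0 \<rightarrowtail> T0"
| "type_of Times = T0 \<rightarrowtail> T0 \<rightarrowtail> T0"
| "type_of (Kc \<rho> \<tau>) = \<rho> \<rightarrowtail> \<tau> \<rightarrowtail> \<rho>"
| "type_of (Sc \<rho> \<sigma> \<tau>) = (\<rho> \<rightarrowtail> \<sigma> \<rightarrowtail> \<tau>) \<rightarrowtail> (\<rho> \<rightarrowtail> \<sigma>) \<rightarrowtail> \<rho> \<rightarrowtail> \<tau>"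
| "type_of Rc = (T0 \<rightarrowtail> T0 \<rightarrowtail> T0) \<rightarrowtail> T0 \<rightarrowtail> T0 \<rightarrowtail> T0"

fun wt :: "tm \<Rightarrow> bool" where
  "wt (s \<cdot> t) \<longleftrightarrow> wt s \<and> wt t \<and> (\<exists>\<tau>. type_of s = type_of t \<rightarrowtail> \<tau>)"
| "wt _ \<longleftrightarrow> True"

primrec fvt :: "tm \<Rightarrow> var set" where
  "fvt (Var x) = {x}"
| "fvt (s \<cdot> t) = fvt s \<union> fvt t"
| "fvt Zero = {}"
| "fvt One = {}"
| "fvt Plus = {}"
| "fvt Times = {}"
| "fvt (Kc \<rho> \<tau>) = {}"
| "fvt (Sc \<rho> \<sigma> \<tau>) = {}"
| "fvt Rc = {}"

primrec substt :: "var \<Rightarrow> tm \<Rightarrow> tm \<Rightarrow> tm" where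
  "substt x u (Var y) = (if x = y then u else Var y)"
| "substt x u (s \<cdot> t) = substt x u s \<cdot> substt x u t"
| "substt x u Zero = Zero"
| "substt x u One = One"
| "substt x u Plus = Plus"
| "substt x u Times = Times"
| "substt x u (Kc \<rho> \<tau>) = Kc \<rho> \<tau>"
| "substt x u (Sc \<rho> \<sigma> \<tau>) = Sc \<rho> \<sigma> \<tau>"
| "substt x u Rc = Rc"

text \<open>The only atomic formulas are equations and inequalities between terms of type 0.\<close>

datatype fm = Eq tm tm | Less tm tm | Falsum | Imp fm fm | All var fm

abbreviation Neg :: "fm \<Rightarrow> fm" where "Neg A \<equiv> Imp A Falsum"
abbreviation Conj :: "fm \<Rightarrow> fm \<Rightarrow> fm" where "Conj A B \<equiv> Neg (Imp A (Neg B))"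
abbreviation Disj :: "fm \<Rightarrow> fm \<Rightarrow> fm" where "Disj A B \<equiv> Imp (Neg A) B"
abbreviation Ex :: "var \<Rightarrow> fm \<Rightarrow> fm" where "Ex x A \<equiv> Neg (All x (Neg A))"

primrec wff :: "fm \<Rightarrow> bool" where
  "wff (Eq s t) \<longleftrightarrow> wt s \<and> wt t \<and> type_of s = T0 \<and> type_of t = T0"
| "wff (Less s t) \<longleftrightarrow> wt s \<and> wt t \<and> type_of s = T0 \<and> type_of t = T0"
| "wff Falsum \<longleftrightarrow> True"
| "wff (Imp A B) \<longleftrightarrow> wff A \<and> wff B"
| "wff (All x A) \<longleftrightarrow> wff A"

primrec fv :: "fm \<Rightarrow> var set" where
  "fv (Eq s t) = fvt s \<union> fvt t"
| "fv (Less s t) = fvt s \<union> fvt t"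
| "fv Falsum = {}"
| "fv (Imp A B) = fv A \<union> fv B"
| "fv (All x A) = fv A - {x}"

primrec subst :: "var \<Rightarrow> tm \<Rightarrow> fm \<Rightarrow> fm" where
  "subst x u (Eq s t) = Eq (substt x u s) (substt x u t)"
| "subst x u (Less s t) = Less (substt x u s) (substt x u t)"
| "subst x u Falsum = Falsum"
| "subst x u (Imp A B) = Imp (subst x u A) (subst x u B)"
| "subst x u (All y A) = (if x = y then All y A else All y (subst x u A))"

text \<open>\<open>free_for u x A\<close>: no variable of \<open>u\<close> is captured in \<open>subst x u A\<close>.\<close>

primrec free_for :: "tm \<Rightarrow> var \<Rightarrow> fm \<Rightarrow> bool" where
  "free_for u x (Eq s t) \<longleftrightarrow> True"
| "free_for u x (Less s t) \<longleftrightarrow> True"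
| "free_for u x Falsum \<longleftrightarrow> True"
| "free_for u x (Imp A B) \<longleftrightarrow> free_for u x A \<and> free_for u x B"
| "free_for u x (All y A) \<longleftrightarrow> x \<notin> fv (All y A) \<or> (y \<notin> fvt u \<and> free_for u x A)"

primrec qf :: "fm \<Rightarrow> bool" where
  "qf (Eq s t) \<longleftrightarrow> True"
| "qf (Less s t) \<longleftrightarrow> True"
| "qf Falsum \<longleftrightarrow> True"
| "qf (Imp A B) \<longleftrightarrow> qf A \<and> qf B"
| "qf (All x A) \<longleftrightarrow> False"


section \<open>Classical many-sorted derivability\<close>

text \<open>Free variables of the axioms in \<open>T\<close> are read universally: \<open>gen\<close> has no side condition.\<close>

inductive provable :: "fm set \<Rightarrow> fm \<Rightarrow> bool"  (infix "\<turnstile>" 50) for T :: "fm set" where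
  ax: "A \<in> T \<Longrightarrow> wff A \<Longrightarrow> T \<turnstile> A"
| ax_K: "wff A \<Longrightarrow> wff B \<Longrightarrow> T \<turnstile> Imp A (Imp B A)"
| ax_S: "wff A \<Longrightarrow> wff B \<Longrightarrow> wff C \<Longrightarrow>
       T \<turnstile> Imp (Imp A (Imp B C)) (Imp (Imp A B) (Imp A C))"
| double_neg: "wff A \<Longrightarrow> T \<turnstile> Imp (Neg (Neg A)) A"
| inst: "wff A \<Longrightarrow> wt t \<Longrightarrow> type_of t = snd x \<Longrightarrow> free_for t x A \<Longrightarrow>
       T \<turnstile> Imp (All x A) (subst x t A)"
| dist: "wff A \<Longrightarrow> wff B \<Longrightarrow> x \<notin> fv A \<Longrightarrow>
       T \<turnstile> Imp (All x (Imp A B)) (Imp A (All x B))"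
| refl: "wt t \<Longrightarrow> type_of t = T0 \<Longrightarrow> T \<turnstile> Eq t t"
| leibniz: "wff A \<Longrightarrow> wff (Eq s t) \<Longrightarrow> snd x = T0 \<Longrightarrow> free_for s x A \<Longrightarrow> free_for t x A \<Longrightarrow>
       T \<turnstile> Imp (Eq s t) (Imp (subst x s A) (subst x t A))"
| mp: "T \<turnstile> Imp A B \<Longrightarrow> T \<turnstile> A \<Longrightarrow> T \<turnstile> B"
| gen: "T \<turnstile> A \<Longrightarrow> T \<turnstile> All x A"


section \<open>Writing formulas\<close>

text \<open>
  Formulas are written in higher-order abstract syntax: a \<open>sfm\<close> yields a formula once it is
  told how many binders enclose it, and the variable bound under \<open>d\<close> binders gets the index \<open>d\<close>.
  Hence bound variables introduced by the notions below never capture anything, and \<open>sentence\<close>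
  gives a closed formula.
\<close>

type_synonym sfm = "nat \<Rightarrow> fm"

definition sentence :: "sfm \<Rightarrow> fm" where "sentence F = F 0"

definition sall :: "ty \<Rightarrow> (tm \<Rightarrow> sfm) \<Rightarrow> sfm" where
  "sall \<sigma> F = (\<lambda>d. All (d, \<sigma>) (F (Var (d, \<sigma>)) (Suc d)))"
definition sex :: "ty \<Rightarrow> (tm \<Rightarrow> sfm) \<Rightarrow> sfm" where
  "sex \<sigma> F = (\<lambda>d. Ex (d, \<sigma>) (F (Var (d, \<sigma>)) (Suc d)))"

syntax
  "_sall" :: "[pttrn, ty, sfm] \<Rightarrow> sfm"  ("(3\<^bold>\<forall>_\<^bold>:_\<^bold>./ _)" [0, 0, 10] 10)
  "_sex" :: "[pttrn, ty, sfm] \<Rightarrow> sfm"  ("(3\<^bold>\<exists>_\<^bold>:_\<^bold>./ _)" [0, 0, 10] 10)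
translations
  "\<^bold>\<forall>x\<^bold>:\<sigma>\<^bold>. F" \<rightleftharpoons> "CONST sall \<sigma> (\<lambda>x. F)"
  "\<^bold>\<exists>x\<^bold>:\<sigma>\<^bold>. F" \<rightleftharpoons> "CONST sex \<sigma> (\<lambda>x. F)"

definition seq :: "tm \<Rightarrow> tm \<Rightarrow> sfm"  (infix "\<^bold>=" 55) where "(s \<^bold>= t) = (\<lambda>d. Eq s t)"
definition sless :: "tm \<Rightarrow> tm \<Rightarrow> sfm"  (infix "\<^bold><" 55) where "(s \<^bold>< t) = (\<lambda>d. Less s t)"
definition snot :: "sfm \<Rightarrow> sfm"  ("\<^bold>\<not> _" [40] 40) where "(\<^bold>\<not> F) = (\<lambda>d. Neg (F d))"
definition sand :: "sfm \<Rightarrow> sfm \<Rightarrow> sfm"  (infixr "\<^bold>\<and>" 35) where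
  "(F \<^bold>\<and> G) = (\<lambda>d. Conj (F d) (G d))"
definition sor :: "sfm \<Rightarrow> sfm \<Rightarrow> sfm"  (infixr "\<^bold>\<or>" 30) where
  "(F \<^bold>\<or> G) = (\<lambda>d. Disj (F d) (G d))"
definition simplies :: "sfm \<Rightarrow> sfm \<Rightarrow> sfm"  (infixr "\<^bold>\<longrightarrow>" 25) where
  "(F \<^bold>\<longrightarrow> G) = (\<lambda>d. Imp (F d) (G d))"
definition siff :: "sfm \<Rightarrow> sfm \<Rightarrow> sfm"  (infixr "\<^bold>\<longleftrightarrow>" 25) where
  "(F \<^bold>\<longleftrightarrow> G) = ((F \<^bold>\<longrightarrow> G) \<^bold>\<and> (G \<^bold>\<longrightarrow> F))"

lemmas sfm_defs = sentence_def sall_def sex_def seq_def sless_def snot_def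
  sand_def sor_def simplies_def siff_def

definition addt :: "tm \<Rightarrow> tm \<Rightarrow> tm"  (infixl "\<oplus>" 65) where "s \<oplus> t = Plus \<cdot> s \<cdot> t"
definition mult :: "tm \<Rightarrow> tm \<Rightarrow> tm"  (infixl "\<otimes>" 70) where "s \<otimes> t = Times \<cdot> s \<cdot> t"

primrec eqT :: "ty \<Rightarrow> tm \<Rightarrow> tm \<Rightarrow> sfm" where
  "eqT T0 s t = (s \<^bold>= t)"
| "eqT (\<sigma> \<rightarrowtail> \<tau>) s t = (\<^bold>\<forall>z\<^bold>:\<sigma>\<^bold>. eqT \<tau> (s \<cdot> z) (t \<cdot> z))"

text \<open>\<open>\<lambda>\<close>-abstraction by means of the combinators.\<close>

fun lam :: "var \<Rightarrow> tm \<Rightarrow> tm" where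
  "lam x (Var y) =
     (if x = y then Sc (snd x) (snd x \<rightarrowtail> snd x) (snd x) \<cdot> Kc (snd x) (snd x \<rightarrowtail> snd x) \<cdot> Kc (snd x) (snd x)
      else Kc (snd y) (snd x) \<cdot> Var y)"
| "lam x (s \<cdot> t) = Sc (snd x) (type_of t) (cod (type_of s)) \<cdot> lam x s \<cdot> lam x t"
| "lam x c = Kc (type_of c) (snd x) \<cdot> c"


section \<open>The base theory \<open>RCA\<^sub>0\<^sup>\<omega>\<close>\<close>

definition semiring_axioms :: "fm set" where
  "semiring_axioms = sentence ` {
     \<^bold>\<forall>x\<^bold>:T0\<^bold>. \<^bold>\<forall>y\<^bold>:T0\<^bold>. \<^bold>\<forall>z\<^bold>:T0\<^bold>. (x \<oplus> y) \<oplus> z \<^bold>= x \<oplus> (y \<oplus> z),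
     \<^bold>\<forall>x\<^bold>:T0\<^bold>. \<^bold>\<forall>y\<^bold>:T0\<^bold>. x \<oplus> y \<^bold>= y \<oplus> x,
     \<^bold>\<forall>x\<^bold>:T0\<^bold>. \<^bold>\<forall>y\<^bold>:T0\<^bold>. \<^bold>\<forall>z\<^bold>:T0\<^bold>. (x \<otimes> y) \<otimes> z \<^bold>= x \<otimes> (y \<otimes> z),
     \<^bold>\<forall>x\<^bold>:T0\<^bold>. \<^bold>\<forall>y\<^bold>:T0\<^bold>. x \<otimes> y \<^bold>= y \<otimes> x,
     \<^bold>\<forall>x\<^bold>:T0\<^bold>. \<^bold>\<forall>y\<^bold>:T0\<^bold>. \<^bold>\<forall>z\<^bold>:T0\<^bold>. x \<otimes> (y \<oplus> z) \<^bold>= x \<otimes> y \<oplus> x \<otimes> z,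
     \<^bold>\<forall>x\<^bold>:T0\<^bold>. x \<oplus> Zero \<^bold>= x,
     \<^bold>\<forall>x\<^bold>:T0\<^bold>. x \<otimes> Zero \<^bold>= Zero,
     \<^bold>\<forall>x\<^bold>:T0\<^bold>. x \<otimes> One \<^bold>= x,
     \<^bold>\<forall>x\<^bold>:T0\<^bold>. \<^bold>\<not> (x \<^bold>< x),
     \<^bold>\<forall>x\<^bold>:T0\<^bold>. \<^bold>\<forall>y\<^bold>:T0\<^bold>. \<^bold>\<forall>z\<^bold>:T0\<^bold>. x \<^bold>< y \<^bold>\<and> y \<^bold>< z \<^bold>\<longrightarrow> x \<^bold>< z,
     \<^bold>\<forall>x\<^bold>:T0\<^bold>. \<^bold>\<forall>y\<^bold>:T0\<^bold>. x \<^bold>< y \<^bold>\<or> x \<^bold>= y \<^bold>\<or> y \<^bold>< x,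
     \<^bold>\<forall>x\<^bold>:T0\<^bold>. \<^bold>\<forall>y\<^bold>:T0\<^bold>. \<^bold>\<forall>z\<^bold>:T0\<^bold>. x \<^bold>< y \<^bold>\<longrightarrow> x \<oplus> z \<^bold>< y \<oplus> z,
     \<^bold>\<forall>x\<^bold>:T0\<^bold>. \<^bold>\<forall>y\<^bold>:T0\<^bold>. \<^bold>\<forall>z\<^bold>:T0\<^bold>. Zero \<^bold>< z \<^bold>\<and> x \<^bold>< y \<^bold>\<longrightarrow> x \<otimes> z \<^bold>< y \<otimes> z,
     \<^bold>\<forall>x\<^bold>:T0\<^bold>. \<^bold>\<forall>y\<^bold>:T0\<^bold>. x \<^bold>< y \<^bold>\<longrightarrow> (\<^bold>\<exists>z\<^bold>:T0\<^bold>. x \<oplus> z \<^bold>= y),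
     Zero \<^bold>< One,
     \<^bold>\<forall>x\<^bold>:T0\<^bold>. Zero \<^bold>< x \<^bold>\<longrightarrow> (One \<^bold>= x \<^bold>\<or> One \<^bold>< x),
     \<^bold>\<forall>x\<^bold>:T0\<^bold>. x \<^bold>= Zero \<^bold>\<or> Zero \<^bold>< x}"

definition combinator_axioms :: "fm set" where
  "combinator_axioms =
     {sentence (\<^bold>\<forall>x\<^bold>:\<rho>\<^bold>. \<^bold>\<forall>y\<^bold>:\<tau>\<^bold>. eqT \<rho> (Kc \<rho> \<tau> \<cdot> x \<cdot> y) x) | \<rho> \<tau>. True} \<union>
     {sentence (\<^bold>\<forall>x\<^bold>:\<rho> \<rightarrowtail> \<sigma> \<rightarrowtail> \<tau>\<^bold>. \<^bold>\<forall>y\<^bold>:\<rho> \<rightarrowtail> \<sigma>\<^bold>. \<^bold>\<forall>z\<^bold>:\<rho>\<^bold>.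
        eqT \<tau> (Sc \<rho> \<sigma> \<tau> \<cdot> x \<cdot> y \<cdot> z) (x \<cdot> z \<cdot> (y \<cdot> z))) | \<rho> \<sigma> \<tau>. True}"

definition recursor_axioms :: "fm set" where
  "recursor_axioms = sentence ` {
     \<^bold>\<forall>f\<^bold>:T0 \<rightarrowtail> T0 \<rightarrowtail> T0\<^bold>. \<^bold>\<forall>m\<^bold>:T0\<^bold>. Rc \<cdot> f \<cdot> m \<cdot> Zero \<^bold>= m,
     \<^bold>\<forall>f\<^bold>:T0 \<rightarrowtail> T0 \<rightarrowtail> T0\<^bold>. \<^bold>\<forall>m\<^bold>:T0\<^bold>. \<^bold>\<forall>n\<^bold>:T0\<^bold>.
        Rc \<cdot> f \<cdot> m \<cdot> (n \<oplus> One) \<^bold>= f \<cdot> n \<cdot> (Rc \<cdot> f \<cdot> m \<cdot> n)}"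

definition extensionality_axioms :: "fm set" where
  "extensionality_axioms =
     {sentence (\<^bold>\<forall>x\<^bold>:\<rho>\<^bold>. \<^bold>\<forall>y\<^bold>:\<rho>\<^bold>. \<^bold>\<forall>f\<^bold>:\<rho> \<rightarrowtail> \<tau>\<^bold>. eqT \<rho> x y \<^bold>\<longrightarrow> eqT \<tau> (f \<cdot> x) (f \<cdot> y)) | \<rho> \<tau>. True}"

definition qf_induction :: "fm set" where
  "qf_induction =
     {Imp (subst n Zero A) (Imp (All n (Imp A (subst n (Var n \<oplus> One) A))) (All n A))
       | n A. snd n = T0 \<and> qf A \<and> wff A}"

definition QF_AC :: "ty \<Rightarrow> ty \<Rightarrow> fm set" where
  "QF_AC \<sigma> \<tau> =
     {Imp (All x (Ex y A)) (Ex Y (All x (subst y (Var Y \<cdot> Var x) A)))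
       | x y Y A. snd x = \<sigma> \<and> snd y = \<tau> \<and> snd Y = \<sigma> \<rightarrowtail> \<tau> \<and> x \<noteq> y \<and> Y \<notin> fv A \<and> qf A \<and> wff A}"

definition RCA0\<omega> :: "fm set" where
  "RCA0\<omega> = semiring_axioms \<union> combinator_axioms \<union> recursor_axioms \<union> extensionality_axioms
     \<union> qf_induction \<union> QF_AC T1 T0"


section \<open>The functionals \<open>S\<^sub>k\<^sup>2\<close> and \<open>Z\<^sub>2\<^sup>\<omega>\<close>\<close>

text \<open>The pairing \<open>(s + t)\<^sup>2 + s\<close> is injective (but not surjective).\<close>

definition pair :: "tm \<Rightarrow> tm \<Rightarrow> tm" where
  "pair s t = (s \<oplus> t) \<otimes> (s \<oplus> t) \<oplus> s"

text \<open>
  The code of \<open>\<langle>g(0), \<dots>, g(n-1)\<rangle>\<close>: the empty sequence has code \<open>0\<close>, and extending a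
  sequence with code \<open>c\<close> by \<open>a\<close> gives the code \<open>pair c a + 1\<close>.
\<close>

definition Bar :: tm where
  "Bar = (let g = (0, T1); i = (1, T0); c = (2, T0) in
     lam g (Rc \<cdot> lam i (lam c (pair (Var c) (Var g \<cdot> Var i) \<oplus> One)) \<cdot> Zero))"

definition bar :: "tm \<Rightarrow> tm \<Rightarrow> tm" where "bar g n = Bar \<cdot> g \<cdot> n"

text \<open>The argument \<open>\<langle>bar g\<^sub>1 n, \<dots>, bar g\<^sub>k n\<rangle>\<close> of \<open>f\<close>; for \<open>k = 1\<close> it is \<open>bar g\<^sub>1 n\<close> itself.\<close>

fun bars :: "tm list \<Rightarrow> tm \<Rightarrow> tm" where
  "bars [] n = n"
| "bars (g # gs) n = foldl (\<lambda>c h. pair c (bar h n)) (bar g n) gs"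

text \<open>
  \<open>SigmaNF k f []\<close> is the \<open>\<Sigma>\<^sup>1\<^sub>k\<close>-formula in Kleene normal form with parameter \<open>f\<close>:
  \<open>\<exists>g\<^sub>1 \<forall>g\<^sub>2 \<dots> Q g\<^sub>k Q' n (f(\<langle>bar g\<^sub>1 n, \<dots>, bar g\<^sub>k n\<rangle>) = 0)\<close> with \<open>Q'\<close> dual to \<open>Q\<close>.
  Other parameters in \<open>\<nat>\<close> and \<open>\<nat>\<^sup>\<nat>\<close> are absorbed in \<open>f\<close>.
\<close>

fun SigmaNF PiNF :: "nat \<Rightarrow> tm \<Rightarrow> tm list \<Rightarrow> sfm" where
  "SigmaNF 0 f gs = (\<^bold>\<exists>n\<^bold>:T0\<^bold>. f \<cdot> bars gs n \<^bold>= Zero)"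
| "SigmaNF (Suc k) f gs = (\<^bold>\<exists>g\<^bold>:T1\<^bold>. PiNF k f (gs @ [g]))"
| "PiNF 0 f gs = (\<^bold>\<forall>n\<^bold>:T0\<^bold>. f \<cdot> bars gs n \<^bold>= Zero)"
| "PiNF (Suc k) f gs = (\<^bold>\<forall>g\<^bold>:T1\<^bold>. SigmaNF k f (gs @ [g]))"

definition S2 :: "nat \<Rightarrow> fm" where
  "S2 k = sentence (\<^bold>\<exists>S\<^bold>:T2\<^bold>. \<^bold>\<forall>f\<^bold>:T1\<^bold>.
     (S \<cdot> f \<^bold>= Zero \<^bold>\<or> S \<cdot> f \<^bold>= One) \<^bold>\<and> (S \<cdot> f \<^bold>= Zero \<^bold>\<longleftrightarrow> SigmaNF k f []))"

definition Z2\<omega> :: "fm set" where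
  "Z2\<omega> = RCA0\<omega> \<union> {S2 k | k. k \<ge> 1}"


section \<open>\<open>IND\<^sub>0\<close>\<close>

definition binary :: "tm \<Rightarrow> sfm" where
  "binary f = (\<^bold>\<forall>n\<^bold>:T0\<^bold>. f \<cdot> n \<^bold>= Zero \<^bold>\<or> f \<cdot> n \<^bold>= One)"

text \<open>
  Two-place functionals are curried. A finite sequence \<open>w\<close> of length \<open>k\<close> is represented by an
  object of type \<open>0 \<rightarrow> 1\<close> of which only the values at \<open>m < k\<close> are used.
\<close>

definition IND0 :: fm where
  "IND0 = sentence (\<^bold>\<forall>Y\<^bold>:T1 \<rightarrowtail> T0 \<rightarrowtail> T0\<^bold>.
     (\<^bold>\<forall>n\<^bold>:T0\<^bold>. \<^bold>\<forall>f\<^bold>:T1\<^bold>. \<^bold>\<forall>g\<^bold>:T1\<^bold>.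
        binary f \<^bold>\<and> binary g \<^bold>\<and> Y \<cdot> f \<cdot> n \<^bold>= Zero \<^bold>\<and> Y \<cdot> g \<cdot> n \<^bold>= Zero \<^bold>\<longrightarrow> eqT T1 f g)
     \<^bold>\<longrightarrow> (\<^bold>\<forall>k\<^bold>:T0\<^bold>. \<^bold>\<exists>w\<^bold>:T0 \<rightarrowtail> T1\<^bold>. \<^bold>\<forall>m\<^bold>:T0\<^bold>. m \<^bold>< k \<^bold>\<longrightarrow>
           (binary (w \<cdot> m) \<^bold>\<and> Y \<cdot> (w \<cdot> m) \<cdot> m \<^bold>= Zero \<^bold>\<longleftrightarrow>
            (\<^bold>\<exists>f\<^bold>:T1\<^bold>. binary f \<^bold>\<and> Y \<cdot> f \<cdot> m \<^bold>= Zero))))"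


section \<open>Real numbers\<close>

text \<open>
  \<open>(p, m, d)\<close> stands for the rational \<open>(p - m) / d\<close>; \<open>d\<close> always denotes a positive number.
  The natural number \<open>rat_code a b c\<close> is a code of \<open>(a - b) / (c + 1)\<close>.
\<close>

type_synonym rat_tm = "tm \<times> tm \<times> tm"

definition rat_code :: "tm \<Rightarrow> tm \<Rightarrow> tm \<Rightarrow> tm" where
  "rat_code a b c = pair (pair a b) c"

fun rat_neg :: "rat_tm \<Rightarrow> rat_tm" where
  "rat_neg (p, m, d) = (m, p, d)"

fun rat_diff :: "rat_tm \<Rightarrow> rat_tm \<Rightarrow> rat_tm" where
  "rat_diff (p, m, d) (p', m', d') = (p \<otimes> d' \<oplus> m' \<otimes> d, m \<otimes> d' \<oplus> p' \<otimes> d, d \<otimes> d')"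

fun rat_less :: "rat_tm \<Rightarrow> rat_tm \<Rightarrow> sfm" where
  "rat_less (p, m, d) (p', m', d') = (p \<otimes> d' \<oplus> m' \<otimes> d \<^bold>< p' \<otimes> d \<oplus> m \<otimes> d')"

definition rat_abs_less :: "rat_tm \<Rightarrow> rat_tm \<Rightarrow> sfm" where
  "rat_abs_less q r = (rat_less q r \<^bold>\<and> rat_less (rat_neg q) r)"

definition rat_abs_le :: "rat_tm \<Rightarrow> rat_tm \<Rightarrow> sfm" where
  "rat_abs_le q r = (\<^bold>\<not> rat_less r q \<^bold>\<and> \<^bold>\<not> rat_less r (rat_neg q))"

definition Pow2 :: tm where
  "Pow2 = (let i = (0, T0); c = (1, T0) in Rc \<cdot> lam i (lam c (Var c \<oplus> Var c)) \<cdot> One)"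

text \<open>The rationals \<open>2\<^sup>-\<^sup>n\<close> and \<open>2\<^sup>-\<^sup>n\<^sup>+\<^sup>1\<close>.\<close>

definition two_neg :: "tm \<Rightarrow> rat_tm" where "two_neg n = (One, Zero, Pow2 \<cdot> n)"
definition two_neg1 :: "tm \<Rightarrow> rat_tm" where "two_neg1 n = (One \<oplus> One, Zero, Pow2 \<cdot> n)"

text \<open>\<open>approx x n F\<close>: \<open>x(n)\<close> is the code of a rational with property \<open>F\<close>.\<close>

definition approx :: "tm \<Rightarrow> tm \<Rightarrow> (rat_tm \<Rightarrow> sfm) \<Rightarrow> sfm" where
  "approx x n F = (\<^bold>\<exists>a\<^bold>:T0\<^bold>. \<^bold>\<exists>b\<^bold>:T0\<^bold>. \<^bold>\<exists>c\<^bold>:T0\<^bold>. x \<cdot> n \<^bold>= rat_code a b c \<^bold>\<and> F (a, b, c \<oplus> One))"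

definition is_real :: "tm \<Rightarrow> sfm" where
  "is_real x = (\<^bold>\<forall>n\<^bold>:T0\<^bold>. \<^bold>\<forall>i\<^bold>:T0\<^bold>.
     approx x n (\<lambda>q. approx x (n \<oplus> i) (\<lambda>r. rat_abs_less (rat_diff q r) (two_neg n))))"

definition real_eq :: "tm \<Rightarrow> tm \<Rightarrow> sfm" where
  "real_eq x y = (\<^bold>\<forall>n\<^bold>:T0\<^bold>.
     approx x n (\<lambda>q. approx y n (\<lambda>r. rat_abs_le (rat_diff q r) (two_neg1 n))))"

definition real_less :: "tm \<Rightarrow> tm \<Rightarrow> sfm" where
  "real_less x y = (\<^bold>\<exists>n\<^bold>:T0\<^bold>.
     approx x n (\<lambda>q. approx y n (\<lambda>r. rat_less (two_neg1 n) (rat_diff r q))))"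

definition real_le :: "tm \<Rightarrow> tm \<Rightarrow> sfm" where
  "real_le x y = (\<^bold>\<not> real_less y x)"

definition real0 :: tm where "real0 = Kc T0 T0 \<cdot> rat_code Zero Zero Zero"
definition real1 :: tm where "real1 = Kc T0 T0 \<cdot> rat_code One Zero Zero"

definition unit_interval :: "tm \<Rightarrow> sfm" where
  "unit_interval x = (is_real x \<^bold>\<and> real_le real0 x \<^bold>\<and> real_le x real1)"

text \<open>
  \<open>y \<in> B(x, 2\<^sup>-\<^sup>k)\<close>, i.e. \<open>real_less\<close> between the real \<open>|x - y|\<close>, whose \<open>n\<close>-th approximation
  is \<open>|x(n+1) - y(n+1)|\<close>, and the constant sequence \<open>2\<^sup>-\<^sup>k\<close>.
\<close>

definition in_ball :: "tm \<Rightarrow> tm \<Rightarrow> tm \<Rightarrow> sfm" where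
  "in_ball y x k = (\<^bold>\<exists>n\<^bold>:T0\<^bold>.
     approx x (n \<oplus> One) (\<lambda>q. approx y (n \<oplus> One) (\<lambda>r.
       rat_abs_less (rat_diff q r) (rat_diff (two_neg k) (two_neg1 n)))))"


section \<open>The Baire category theorem for \<open>[0,1]\<close>\<close>

text \<open>A sequence of sets of reals \<open>O\<close> is an object of type \<open>1 \<rightarrow> 0 \<rightarrow> 0\<close>; \<open>x \<in> O\<^sub>n\<close> is \<open>O(x,n) = 1\<close>.\<close>

definition mem :: "tm \<Rightarrow> tm \<Rightarrow> tm \<Rightarrow> sfm" where
  "mem x U n = (U \<cdot> x \<cdot> n \<^bold>= One)"

definition set_seq :: "tm \<Rightarrow> sfm" where
  "set_seq U = (\<^bold>\<forall>n\<^bold>:T0\<^bold>.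
     (\<^bold>\<forall>x\<^bold>:T1\<^bold>. is_real x \<^bold>\<longrightarrow> U \<cdot> x \<cdot> n \<^bold>= Zero \<^bold>\<or> U \<cdot> x \<cdot> n \<^bold>= One) \<^bold>\<and>
     (\<^bold>\<forall>x\<^bold>:T1\<^bold>. \<^bold>\<forall>y\<^bold>:T1\<^bold>. is_real x \<^bold>\<and> is_real y \<^bold>\<and> real_eq x y \<^bold>\<longrightarrow> U \<cdot> x \<cdot> n \<^bold>= U \<cdot> y \<cdot> n))"

definition within_unit :: "tm \<Rightarrow> tm \<Rightarrow> sfm" where
  "within_unit U n = (\<^bold>\<forall>x\<^bold>:T1\<^bold>. is_real x \<^bold>\<and> mem x U n \<^bold>\<longrightarrow> unit_interval x)"

definition open_unit :: "tm \<Rightarrow> tm \<Rightarrow> sfm" where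
  "open_unit U n = (\<^bold>\<forall>x\<^bold>:T1\<^bold>. unit_interval x \<^bold>\<and> mem x U n \<^bold>\<longrightarrow>
     (\<^bold>\<exists>k\<^bold>:T0\<^bold>. \<^bold>\<forall>y\<^bold>:T1\<^bold>. unit_interval y \<^bold>\<and> in_ball y x k \<^bold>\<longrightarrow> mem y U n))"

definition dense_unit :: "tm \<Rightarrow> tm \<Rightarrow> sfm" where
  "dense_unit U n = (\<^bold>\<forall>x\<^bold>:T1\<^bold>. \<^bold>\<forall>k\<^bold>:T0\<^bold>. unit_interval x \<^bold>\<longrightarrow>
     (\<^bold>\<exists>y\<^bold>:T1\<^bold>. unit_interval y \<^bold>\<and> in_ball y x k \<^bold>\<and> mem y U n))"

definition decreasing_unit :: "tm \<Rightarrow> sfm" where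
  "decreasing_unit U = (\<^bold>\<forall>n\<^bold>:T0\<^bold>. \<^bold>\<forall>x\<^bold>:T1\<^bold>. unit_interval x \<^bold>\<and> mem x U (n \<oplus> One) \<^bold>\<longrightarrow> mem x U n)"

definition BCT01 :: fm where
  "BCT01 = sentence (\<^bold>\<forall>U\<^bold>:T1 \<rightarrowtail> T0 \<rightarrowtail> T0\<^bold>.
     set_seq U \<^bold>\<and> (\<^bold>\<forall>n\<^bold>:T0\<^bold>. within_unit U n \<^bold>\<and> open_unit U n \<^bold>\<and> dense_unit U n) \<^bold>\<and> decreasing_unit U
     \<^bold>\<longrightarrow> (\<^bold>\<exists>x\<^bold>:T1\<^bold>. unit_interval x \<^bold>\<and> (\<^bold>\<forall>n\<^bold>:T0\<^bold>. mem x U n)))"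


section \<open>Well-formedness\<close>

text \<open>
  The rule \<open>ax\<close> ignores ill-typed members of a theory; the following shows that it ignores nothing here.
\<close>

lemma wff_connectives:
  "wff (sall \<sigma> F d) = wff (F (Var (d, \<sigma>)) (Suc d))"
  "wff (sex \<sigma> F d) = wff (F (Var (d, \<sigma>)) (Suc d))"
  "wff ((G \<^bold>\<and> H) d) \<longleftrightarrow> wff (G d) \<and> wff (H d)"
  "wff ((G \<^bold>\<or> H) d) \<longleftrightarrow> wff (G d) \<and> wff (H d)"
  "wff ((G \<^bold>\<longrightarrow> H) d) \<longleftrightarrow> wff (G d) \<and> wff (H d)"
  "wff ((G \<^bold>\<longleftrightarrow> H) d) \<longleftrightarrow> wff (G d) \<and> wff (H d)"
  "wff ((\<^bold>\<not> G) d) \<longleftrightarrow> wff (G d)"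
  "wff ((s \<^bold>= t) d) \<longleftrightarrow> wt s \<and> wt t \<and> type_of s = T0 \<and> type_of t = T0"
  "wff ((s \<^bold>< t) d) \<longleftrightarrow> wt s \<and> wt t \<and> type_of s = T0 \<and> type_of t = T0"
  by (auto simp: sfm_defs)

lemma wt_arith:
  "wt (s \<oplus> t) \<longleftrightarrow> wt s \<and> wt t \<and> type_of s = T0 \<and> type_of t = T0" "type_of (s \<oplus> t) = T0"
  "wt (s \<otimes> t) \<longleftrightarrow> wt s \<and> wt t \<and> type_of s = T0 \<and> type_of t = T0" "type_of (s \<otimes> t) = T0"
  "wt (pair s t) \<longleftrightarrow> wt s \<and> wt t \<and> type_of s = T0 \<and> type_of t = T0" "type_of (pair s t) = T0"
  by (auto simp: addt_def mult_def pair_def)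

lemma wt_Pow2: "wt Pow2" "type_of Pow2 = T1"
  by (simp_all add: Pow2_def addt_def)

lemma wff_is_real: "wt x \<Longrightarrow> type_of x = T1 \<Longrightarrow> wff (is_real x d)"
  by (simp add: is_real_def approx_def rat_abs_less_def rat_code_def two_neg_def
      wff_connectives wt_arith wt_Pow2)

lemma wff_reals:
  assumes "wt x" "wt y" "type_of x = T1" "type_of y = T1"
  shows "wff (real_eq x y d)" "wff (real_less x y d)" "wff (real_le y x d)"
  using assms
  by (simp_all add: real_eq_def real_less_def real_le_def approx_def rat_abs_less_def
      rat_abs_le_def rat_code_def two_neg_def two_neg1_def wff_connectives wt_arith wt_Pow2)

lemma wff_unit_interval: "wt x \<Longrightarrow> type_of x = T1 \<Longrightarrow> wff (unit_interval x d)"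
  by (simp add: unit_interval_def real0_def real1_def rat_code_def wff_connectives wff_is_real wff_reals wt_arith)

lemma wff_in_ball:
  "wt x \<Longrightarrow> wt y \<Longrightarrow> wt k \<Longrightarrow> type_of x = T1 \<Longrightarrow> type_of y = T1 \<Longrightarrow> type_of k = T0 \<Longrightarrow> wff (in_ball y x k d)"
  by (simp add: in_ball_def approx_def rat_abs_less_def rat_code_def two_neg_def two_neg1_def
      wff_connectives wt_arith wt_Pow2)

lemma wff_BCT01: "wff BCT01"
  by (simp add: BCT01_def sentence_def set_seq_def within_unit_def open_unit_def dense_unit_def
      decreasing_unit_def mem_def wff_connectives wff_is_real wff_reals wff_unit_interval wff_in_ball wt_arith)

lemma wff_IND0: "wff IND0"
  by (simp add: IND0_def sentence_def binary_def wff_connectives)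

lemma wt_Bar: "wt Bar \<and> type_of Bar = T1 \<rightarrowtail> T0 \<rightarrowtail> T0 \<and> fvt Bar = {}"
  by (simp add: Bar_def pair_def addt_def mult_def)

lemma wt_bars_foldl:
  "wt c \<Longrightarrow> type_of c = T0 \<Longrightarrow> wt n \<Longrightarrow> type_of n = T0 \<Longrightarrow> \<forall>g\<in>set gs. wt g \<and> type_of g = T1 \<Longrightarrow>
   wt (foldl (\<lambda>c h. pair c (bar h n)) c gs) \<and> type_of (foldl (\<lambda>c h. pair c (bar h n)) c gs) = T0"
  by (induction gs arbitrary: c) (auto simp: wt_arith bar_def wt_Bar)

lemma wt_bars:
  "wt n \<Longrightarrow> type_of n = T0 \<Longrightarrow> \<forall>g\<in>set gs. wt g \<and> type_of g = T1 \<Longrightarrow>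
   wt (bars gs n) \<and> type_of (bars gs n) = T0"
  by (cases gs) (auto simp: wt_bars_foldl[unfolded bar_def] bar_def wt_Bar)

lemma wff_NF:
  "wt f \<Longrightarrow> type_of f = T1 \<Longrightarrow> \<forall>g\<in>set gs. wt g \<and> type_of g = T1 \<Longrightarrow> wff (SigmaNF k f gs d)"
  "wt f \<Longrightarrow> type_of f = T1 \<Longrightarrow> \<forall>g\<in>set gs. wt g \<and> type_of g = T1 \<Longrightarrow> wff (PiNF k f gs d)"
  by (induction k f gs and k f gs arbitrary: d and d rule: SigmaNF_PiNF.induct)
     (auto simp: wff_connectives wt_bars)

lemma wff_S2: "wff (S2 k)"
  by (simp add: S2_def sentence_def wff_connectives wff_NF)

lemma wff_eqT: "wt s \<Longrightarrow> wt t \<Longrightarrow> type_of s = \<sigma> \<Longrightarrow> type_of t = \<sigma> \<Longrightarrow> wff (eqT \<sigma> s t d)"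
  by (induction \<sigma> arbitrary: s t d) (auto simp: wff_connectives)

lemma wt_substt:
  "wt t \<Longrightarrow> wt u \<Longrightarrow> type_of u = snd x \<Longrightarrow> wt (substt x u t) \<and> type_of (substt x u t) = type_of t"
  by (induction t) auto

lemma wff_subst: "wff A \<Longrightarrow> wt u \<Longrightarrow> type_of u = snd x \<Longrightarrow> wff (subst x u A)"
  by (induction A) (auto simp: wt_substt)

lemma wff_Z2\<omega>: "\<forall>A\<in>Z2\<omega>. wff A"
proof -
  have "\<forall>A\<in>RCA0\<omega>. wff A"
    unfolding RCA0\<omega>_def semiring_axioms_def combinator_axioms_def recursor_axioms_def
      extensionality_axioms_def qf_induction_def QF_AC_def
    by (auto simp: sentence_def wff_connectives wt_arith wff_eqT wff_subst)
  then show ?thesis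
    by (auto simp: Z2\<omega>_def wff_S2)
qed

lemma provable_wff: "T \<turnstile> A \<Longrightarrow> wff A"
  by (induction rule: provable.induct) (auto intro!: wff_subst)

end

theory Submission
  imports Defs Complex_Main "HOL-Library.Countable" "HOL-Library.Nat_Bijection"
begin

text \<open>
  The proof builds a model with standard numbers. Its sequences form a countable set \<open>seqs\<close>, the
  union of a chain of countable levels, each closed under countably many operations (among them
  recursion, minimization and Skolem functions for projective formulas) and enumerated by an
  element of the next level. Thus \<open>seqs\<close> is an elementary part of \<open>\<nat>\<^sup>\<nat>\<close>, and the functionals
  \<open>S\<^sub>k\<^sup>2\<close> map sequences of elements of \<open>seqs\<close> that are coded in \<open>seqs\<close> to elements of \<open>seqs\<close>.
  The objects of higher type are codes of functionals with exactly this property, hereditarily.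
  Since each element of \<open>seqs\<close> lies in some level, a coded sequence of reals stays within one
  level, whence also the map \<open>rank\<close> that sends a real to its place in the hierarchy is in the model.
  It is finite-to-one, so the sets \<open>{x. n < rank x}\<close> are dense, open and decreasing, but their
  intersection is empty. The principle \<open>IND\<^sub>0\<close> holds because the numbers are standard.
\<close>


section \<open>Coded reals and projective truth in the standard universe\<close>

text \<open>The tension is to keep \<open>rank\<close> and all functionals deciding projective
  formulas in one model. They coexist because those formulas take only numbers and sequences as
  parameters: \<open>rank\<close> cannot occur in them, so they cannot be used to search for the
  real at a given address and to diagonalize against it. No member of \<open>seqs\<close> can list
  all of \<open>seqs\<close>, because the diagonal sequence would belong to it as well. Enumerations
  of initial parts of the hierarchy are enough to compute \<open>rank\<close> on any one coded
  sequence, which is why the universe is stratified. The closure operations refer to truth over all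
  sequences of numbers and not to truth over \<open>seqs\<close>: they must make sense before
  \<open>seqs\<close> is defined. The two notions of truth are reconciled afterwards by the Skolem
  functions.\<close>

definition pairv :: "nat \<Rightarrow> nat \<Rightarrow> nat" where
  "pairv s t = (s + t) * (s + t) + s"

text \<open>The values with \<open>s + t = k\<close> lie between \<open>k * k\<close> and
  \<open>k * k + k\<close>, and these blocks are disjoint for different \<open>k\<close>; within a
  block the value determines \<open>s\<close>.\<close>

lemma pairv_inject: "pairv a b = pairv c d \<longleftrightarrow> a = c \<and> b = d"
proof
  assume eq: "pairv a b = pairv c d"
  have bound: "x + y < x' + y' \<Longrightarrow> pairv x y < pairv x' y'" for x y x' y'
  proof -
    assume "x + y < x' + y'"
    then have "(x + y + 1) * (x + y + 1) \<le> (x' + y') * (x' + y')"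
      by (intro mult_mono) auto
    then show ?thesis
      by (simp add: pairv_def)
  qed
  have "a + b = c + d"
    using bound[of a b c d] bound[of c d a b] eq by linarith
  with eq show "a = c \<and> b = d"
    by (simp add: pairv_def)
qed simp

primrec barv :: "(nat \<Rightarrow> nat) \<Rightarrow> nat \<Rightarrow> nat" where
  "barv g 0 = 0"
| "barv g (Suc n) = pairv (barv g n) (g n) + 1"

fun barsv :: "(nat \<Rightarrow> nat) list \<Rightarrow> nat \<Rightarrow> nat" where
  "barsv [] n = n"
| "barsv (g # gs) n = foldl (\<lambda>c h. pairv c (barv h n)) (barv g n) gs"

text \<open>The function quantifiers range over all sequences, not only over \<open>seqs\<close>;
  \<open>sat_NF\<close> shows that this makes no difference for parameters in
  \<open>seqs\<close>.\<close>

fun trS trP :: "nat \<Rightarrow> (nat \<Rightarrow> nat) \<Rightarrow> (nat \<Rightarrow> nat) list \<Rightarrow> bool" where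
  "trS 0 f gs = (\<exists>n. f (barsv gs n) = 0)"
| "trS (Suc k) f gs = (\<exists>g. trP k f (gs @ [g]))"
| "trP 0 f gs = (\<forall>n. f (barsv gs n) = 0)"
| "trP (Suc k) f gs = (\<forall>g. trS k f (gs @ [g]))"

definition rcode :: "nat \<Rightarrow> nat \<Rightarrow> nat \<Rightarrow> nat" where
  "rcode a b c = pairv (pairv a b) c"

text \<open>As \<open>pairv\<close> is not surjective, some numbers code no rational. Nothing is
  known of the value there, which is why \<open>isr\<close> asks for codes separately.\<close>

definition qv :: "nat \<Rightarrow> real" where
  "qv z = (THE r. \<exists>a b c. z = rcode a b c \<and> r = (real a - real b) / (real c + 1))"

lemma rcode_inject: "rcode a b c = rcode a' b' c' \<longleftrightarrow> a = a' \<and> b = b' \<and> c = c'"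
  by (auto simp: rcode_def pairv_inject)

lemma qv_rcode: "qv (rcode a b c) = (real a - real b) / (real c + 1)"
  unfolding qv_def by (rule the_equality) (auto simp: rcode_inject)

definition isr :: "(nat \<Rightarrow> nat) \<Rightarrow> bool" where
  "isr x \<longleftrightarrow> (\<forall>n. \<exists>a b c. x n = rcode a b c) \<and> (\<forall>n i. \<bar>qv (x n) - qv (x (n + i))\<bar> < 1 / 2 ^ n)"

definition rval :: "(nat \<Rightarrow> nat) \<Rightarrow> real" where
  "rval x = lim (\<lambda>n. qv (x n))"

definition unitr :: "(nat \<Rightarrow> nat) \<Rightarrow> bool" where
  "unitr x \<longleftrightarrow> isr x \<and> 0 \<le> rval x \<and> rval x \<le> 1"

section \<open>A countable elementary universe of sequences\<close>

definition row :: "nat \<Rightarrow> (nat \<Rightarrow> nat) \<Rightarrow> nat \<Rightarrow> nat" where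
  "row i f = (\<lambda>m. f (prod_encode (i, m)))"

definition consf :: "(nat \<Rightarrow> nat) \<Rightarrow> (nat \<Rightarrow> nat) \<Rightarrow> nat \<Rightarrow> nat" where
  "consf f g = (\<lambda>m. case prod_decode m of (i, j) \<Rightarrow> (case i of 0 \<Rightarrow> f j | Suc i' \<Rightarrow> g (prod_encode (i', j))))"

lemma row_consf: "row 0 (consf f g) = f" "row (Suc i) (consf f g) = row i g"
  by (auto simp: row_def consf_def)

text \<open>The array is a parameter so that the same search can run on \<open>en\<close> and on the
  rows of a single \<open>gen k\<close>. Minimizing \<open>j\<close> before \<open>i\<close> keeps
  the search inside the levels up to the first one that contains the real. Only the value of
  \<open>x\<close> enters, so equal reals get equal results.\<close>

definition idxf :: "(nat \<Rightarrow> nat \<Rightarrow> nat \<Rightarrow> nat) \<Rightarrow> (nat \<Rightarrow> nat) \<Rightarrow> nat" where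
  "idxf a x =
    (let same = (\<lambda>j i. isr (a j i) \<and> rval (a j i) = rval x);
         j = (LEAST j. \<exists>i. same j i)
     in prod_encode (j, LEAST i. same j i))"

text \<open>
  \<open>OSkS\<close> and \<open>OSkP\<close> are Skolem functions: closure under them makes a set of sequences elementary in
  \<open>\<nat>\<^sup>\<nat>\<close> for the normal forms \<open>trS\<close> and \<open>trP\<close>. \<open>OIdx\<close> finds reals in a list of enumerations.
\<close>

datatype opn = OId | OConst nat | OComp | OPair | OFst | OSnd | OAdd | OMul | OEq | OLess | OImp
  | OCons | ORow nat | ORec | OMu | OTr nat | OSkS nat nat | OSkP nat nat | OIdx

primrec opf :: "opn \<Rightarrow> (nat \<Rightarrow> nat) \<Rightarrow> (nat \<Rightarrow> nat) \<Rightarrow> nat \<Rightarrow> nat" where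
  "opf OId f g = (\<lambda>n. n)"
| "opf (OConst c) f g = (\<lambda>n. c)"
| "opf OComp f g = (\<lambda>n. f (g n))"
| "opf OPair f g = (\<lambda>n. prod_encode (f n, g n))"
| "opf OFst f g = (\<lambda>n. fst (prod_decode n))"
| "opf OSnd f g = (\<lambda>n. snd (prod_decode n))"
| "opf OAdd f g = (\<lambda>n. f n + g n)"
| "opf OMul f g = (\<lambda>n. f n * g n)"
| "opf OEq f g = (\<lambda>n. of_bool (f n = g n))"
| "opf OLess f g = (\<lambda>n. of_bool (f n < g n))"
| "opf OImp f g = (\<lambda>n. of_bool (f n = 1 \<longrightarrow> g n = 1))"
| "opf OCons f g = consf f g"
| "opf (ORow i) f g = row i f"
| "opf ORec f g = (\<lambda>n. rec_nat (fst (prod_decode (g n)))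
      (\<lambda>i c. f (prod_encode (n, prod_encode (i, c)))) (snd (prod_decode (g n))))"
| "opf OMu f g = (\<lambda>n. LEAST m. f (prod_encode (n, m)) = 1)"
| "opf (OTr k) f g = (\<lambda>n. if trS k (row n f) [] then 0 else 1)"
| "opf (OSkS k j) f g = (SOME h. trP k f (map (\<lambda>i. row i g) [0..<j] @ [h]))"
| "opf (OSkP k j) f g = (SOME h. \<not> trS k f (map (\<lambda>i. row i g) [0..<j] @ [h]))"
| "opf OIdx f g = (\<lambda>n. if unitr (row n g) then Suc (idxf (\<lambda>j i. row i (row j f)) (row n g)) else 0)"

datatype trm = Gen | Op opn trm trm

instance opn :: countable by countable_datatype
instance trm :: countable by countable_datatype

primrec evalt :: "(nat \<Rightarrow> nat) \<Rightarrow> trm \<Rightarrow> nat \<Rightarrow> nat" where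
  "evalt a Gen = a"
| "evalt a (Op p s t) = opf p (evalt a s) (evalt a t)"

text \<open>\<open>gen k\<close> codes enumerations of the levels below \<open>k\<close>; level \<open>k\<close> is its closure under \<open>opf\<close>.\<close>

primrec gen :: "nat \<Rightarrow> nat \<Rightarrow> nat" where
  "gen 0 = (\<lambda>_. 0)"
| "gen (Suc k) = (\<lambda>m. case prod_decode m of (j, r) \<Rightarrow>
     if j = k then (case prod_decode r of (i, l) \<Rightarrow> evalt (gen k) (from_nat i) l) else gen k m)"

definition en :: "nat \<Rightarrow> nat \<Rightarrow> nat \<Rightarrow> nat" where
  "en k i = evalt (gen k) (from_nat i)"

definition level :: "nat \<Rightarrow> (nat \<Rightarrow> nat) set" where
  "level k = range (evalt (gen k))"

definition seqs :: "(nat \<Rightarrow> nat) set" where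
  "seqs = (\<Union>k. level k)"

section \<open>Closure properties of the levels and of their union\<close>

lemma range_en: "range (en k) = level k"
proof -
  have "en k = evalt (gen k) \<circ> from_nat"
    by (auto simp: en_def)
  then show ?thesis
    by (simp only: level_def image_comp[symmetric] surj_from_nat)
qed

text \<open>The row with index \<open>j\<close> is written in the step to \<open>Suc j\<close>, and
  every later step only overrides a row with a larger index.\<close>

lemma row_gen: "j < k \<Longrightarrow> row i (row j (gen k)) = en j i"
  by (induction k) (auto simp: row_def en_def less_Suc_eq fun_eq_iff)

lemma level_op: "f \<in> level k \<Longrightarrow> g \<in> level k \<Longrightarrow> opf p f g \<in> level k"
  unfolding level_def by (metis evalt.simps(2) rangeE rangeI)

lemma gen_level: "gen k \<in> level k"
  unfolding level_def by (metis evalt.simps(1) rangeI)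

text \<open>The generator changes from \<open>gen k\<close> to \<open>gen (Suc k)\<close>, so old
  terms get new values. But each old element is listed in \<open>gen (Suc k)\<close> and is
  recovered by two applications of \<open>ORow\<close>.\<close>

lemma level_Suc: "level k \<subseteq> level (Suc k)"
proof
  fix f assume "f \<in> level k"
  then obtain i where "f = en k i"
    using range_en by blast
  then have "f = opf (ORow i) (opf (ORow k) (gen (Suc k)) (gen (Suc k))) (gen (Suc k))"
    by (simp add: row_gen del: gen.simps)
  then show "f \<in> level (Suc k)"
    by (metis gen_level level_op)
qed

lemma level_mono: "j \<le> k \<Longrightarrow> level j \<subseteq> level k"
  by (rule lift_Suc_mono_le[of level]) (rule level_Suc)

lemma seqs_op:
  assumes "f \<in> seqs" "g \<in> seqs"
  shows "opf p f g \<in> seqs"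
proof -
  obtain j k where "f \<in> level j" "g \<in> level k"
    using assms unfolding seqs_def by blast
  then have "f \<in> level (max j k)" "g \<in> level (max j k)"
    using level_mono[of j "max j k"] level_mono[of k "max j k"] by auto
  then show ?thesis
    unfolding seqs_def using level_op by blast
qed

lemma gen_seqs: "gen k \<in> seqs"
  using gen_level seqs_def by blast

lemma seqs_simple:
  "(\<lambda>n. n) \<in> seqs" "(\<lambda>n. c) \<in> seqs" "(\<lambda>n. fst (prod_decode n)) \<in> seqs" "(\<lambda>n. snd (prod_decode n)) \<in> seqs"
  using seqs_op[OF gen_seqs gen_seqs, of OId] seqs_op[OF gen_seqs gen_seqs, of "OConst c"]
    seqs_op[OF gen_seqs gen_seqs, of OFst] seqs_op[OF gen_seqs gen_seqs, of OSnd]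
  by simp_all

lemma seqs_comp: "f \<in> seqs \<Longrightarrow> g \<in> seqs \<Longrightarrow> (\<lambda>n. f (g n)) \<in> seqs"
  using seqs_op[of f g OComp] by simp

lemma seqs_binary:
  assumes "f \<in> seqs" "g \<in> seqs"
  shows "(\<lambda>n. prod_encode (f n, g n)) \<in> seqs" "(\<lambda>n. f n + g n) \<in> seqs" "(\<lambda>n. f n * g n) \<in> seqs"
    "(\<lambda>n. of_bool (f n = g n)) \<in> seqs" "(\<lambda>n. of_bool (f n < g n)) \<in> seqs"
    "(\<lambda>n. of_bool (f n = 1 \<longrightarrow> g n = 1)) \<in> seqs" "consf f g \<in> seqs"
  using seqs_op[OF assms, of OPair] seqs_op[OF assms, of OAdd] seqs_op[OF assms, of OMul]
    seqs_op[OF assms, of OEq] seqs_op[OF assms, of OLess] seqs_op[OF assms, of OImp]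
    seqs_op[OF assms, of OCons]
  by simp_all

lemma seqs_projections:
  assumes "f \<in> seqs"
  shows "(\<lambda>n. fst (prod_decode (f n))) \<in> seqs" "(\<lambda>n. snd (prod_decode (f n))) \<in> seqs"
  using seqs_comp[OF seqs_simple(3) assms] seqs_comp[OF seqs_simple(4) assms] by auto

lemma seqs_row: "f \<in> seqs \<Longrightarrow> row i f \<in> seqs"
  using seqs_op[of f f "ORow i"] by simp

lemma seqs_rec:
  assumes "f \<in> seqs" "m \<in> seqs" "k \<in> seqs"
  shows "(\<lambda>n. rec_nat (m n) (\<lambda>i c. f (prod_encode (n, prod_encode (i, c)))) (k n)) \<in> seqs"
  using seqs_op[OF assms(1) seqs_binary(1)[OF assms(2,3)], of ORec] by simp

lemma seqs_least:
  assumes "f \<in> seqs"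
  shows "(\<lambda>n. LEAST m. f (prod_encode (n, m)) = 1) \<in> seqs"
  using seqs_op[OF assms assms, of OMu] by simp

lemma seqs_truth:
  assumes "f \<in> seqs"
  shows "(\<lambda>n. if trS k (row n f) [] then 0 else 1) \<in> seqs"
  using seqs_op[OF assms assms, of "OTr k"] by simp

text \<open>Finitely many uses of \<open>consf\<close> suffice, however the members were chosen.
  This lets Skolem functions receive a list of parameters as one sequence, and it is the source of
  the finite sequences in \<open>sat_IND0\<close>.\<close>

lemma seqs_code_list:
  "set gs \<subseteq> seqs \<Longrightarrow> \<exists>h\<in>seqs. \<forall>i<length gs. row i h = gs ! i"
proof (induction gs)
  case Nil
  then show ?case using seqs_simple by auto
next
  case (Cons g gs)
  then obtain h where h: "h \<in> seqs" "\<forall>i<length gs. row i h = gs ! i" by auto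
  have "\<forall>i<length (g # gs). row i (consf g h) = (g # gs) ! i"
    using h(2) by (auto simp: row_consf nth_Cons split: nat.split)
  then show ?case
    using seqs_binary(7)[of g h] h(1) Cons.prems by auto
qed

lemma seqs_map_rows:
  assumes "set gs \<subseteq> seqs"
  obtains h where "h \<in> seqs" "map (\<lambda>i. row i h) [0..<length gs] = gs"
  using seqs_code_list[OF assms] by (metis (no_types, lifting) add_0 length_map length_upt nth_equalityI nth_map nth_upt diff_zero)

text \<open>One half of the Tarski-Vaught test: the term \<open>OSkS\<close> names a witness chosen
  in the full universe. The next lemma is the half for counterexamples.\<close>

lemma seqs_skolem_S:
  assumes "f \<in> seqs" "set gs \<subseteq> seqs" "trP k f (gs @ [g])"
  shows "\<exists>g\<in>seqs. trP k f (gs @ [g])"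
proof -
  obtain h where h: "h \<in> seqs" "map (\<lambda>i. row i h) [0..<length gs] = gs"
    using seqs_map_rows[OF assms(2)] .
  have "trP k f (gs @ [opf (OSkS k (length gs)) f h])"
    using someI[of "\<lambda>g. trP k f (gs @ [g])", OF assms(3)] h(2) by simp
  then show ?thesis
    using seqs_op[OF assms(1) h(1)] by blast
qed

lemma seqs_skolem_P:
  assumes "f \<in> seqs" "set gs \<subseteq> seqs" "\<not> trS k f (gs @ [g])"
  shows "\<exists>g\<in>seqs. \<not> trS k f (gs @ [g])"
proof -
  obtain h where h: "h \<in> seqs" "map (\<lambda>i. row i h) [0..<length gs] = gs"
    using seqs_map_rows[OF assms(2)] .
  have "\<not> trS k f (gs @ [opf (OSkP k (length gs)) f h])"
    using someI[of "\<lambda>g. \<not> trS k f (gs @ [g])", OF assms(3)] h(2) by simp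
  then show ?thesis
    using seqs_op[OF assms(1) h(1)] by blast
qed

text \<open>
  The first level containing a representation of a real, paired with the position of that
  representation, plus 1: finite-to-one on the real numbers of the model.
\<close>

definition rank :: "(nat \<Rightarrow> nat) \<Rightarrow> nat" where
  "rank x = (if unitr x then Suc (idxf en x) else 0)"

text \<open>The hit at level \<open>k\<close> bounds the least \<open>j\<close> by \<open>k\<close>
  for both arrays, so a disagreement beyond \<open>k\<close> is never seen.\<close>

lemma idxf_cong:
  assumes "\<And>j i. j \<le> k \<Longrightarrow> a j i = b j i" "isr (a k i)" "rval (a k i) = rval x"
  shows "idxf a x = idxf b x"
proof -
  let ?P = "\<lambda>a j. \<exists>i. isr (a j i) \<and> rval (a j i) = rval x"
  have 1: "?P a k" "?P b k" using assms by auto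
  have le: "(LEAST j. ?P a j) \<le> k" "(LEAST j. ?P b j) \<le> k"
    using 1 by (auto intro!: Least_le)
  have ex: "?P a (LEAST j. ?P a j)" "?P b (LEAST j. ?P b j)"
    using LeastI[of "?P a", OF 1(1)] LeastI[of "?P b", OF 1(2)] by auto
  have "(LEAST j. ?P a j) = (LEAST j. ?P b j)"
    using le ex assms(1) by (intro antisym Least_le) auto
  then show ?thesis
    using le assms(1) by (simp add: idxf_def Let_def)
qed

text \<open>If \<open>g\<close> is in \<open>level k\<close>, so are all its rows, by closure under
  \<open>ORow\<close>. Hence no search goes beyond \<open>k\<close>, and the single sequence
  \<open>gen (Suc k)\<close>, which lists the levels up to \<open>k\<close>, can replace
  \<open>en\<close> uniformly in \<open>n\<close>.\<close>

lemma seqs_rank: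
  assumes "g \<in> seqs"
  shows "(\<lambda>n. rank (row n g)) \<in> seqs"
proof -
  obtain k where k: "g \<in> level k" using assms seqs_def by blast
  have "rank (row n g) = opf OIdx (gen (Suc k)) g n" for n
  proof (cases "unitr (row n g)")
    case True
    have "row n g \<in> level k"
      using level_op[OF k k, of "ORow n"] by simp
    then obtain i where "row n g = en k i" using range_en by blast
    then have "idxf en (row n g) = idxf (\<lambda>j i. row i (row j (gen (Suc k)))) (row n g)"
      using True by (intro idxf_cong[where k = k and i = i]) (auto simp: row_gen unitr_def simp del: gen.simps)
    then show ?thesis using True by (simp add: rank_def del: gen.simps)
  qed (simp add: rank_def)
  then have "(\<lambda>n. rank (row n g)) = opf OIdx (gen (Suc k)) g" by blast
  then show ?thesis using seqs_op[OF gen_seqs assms] by metis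
qed

text \<open>Every \<open>x\<close> in \<open>seqs\<close> is some \<open>en k i\<close>, so both
  minimizations in \<open>idxf\<close> succeed and \<open>rank x - 1\<close> is the address of a
  representation of the same real.\<close>

lemma rval_rank:
  assumes "x \<in> seqs" "unitr x"
  shows "case prod_decode (rank x - 1) of (j, i) \<Rightarrow> rval (en j i) = rval x"
proof -
  obtain k where "x \<in> level k" using assms(1) seqs_def by blast
  then obtain i where i: "x = en k i" using range_en by blast
  let ?P = "\<lambda>j i. isr (en j i) \<and> rval (en j i) = rval x"
  have "\<exists>j i. ?P j i" using assms(2) i unitr_def by auto
  then have "\<exists>i. ?P (LEAST j. \<exists>i. ?P j i) i"
    by (rule LeastI_ex)
  then have "?P (LEAST j. \<exists>i. ?P j i) (LEAST i. ?P (LEAST j. \<exists>i. ?P j i) i)"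
    by (rule LeastI_ex)
  then show ?thesis
    using assms(2) by (simp add: rank_def idxf_def Let_def)
qed

lemma rank_cong: "unitr x \<Longrightarrow> unitr y \<Longrightarrow> rval x = rval y \<Longrightarrow> rank x = rank y"
  by (simp add: rank_def idxf_def)

text \<open>By \<open>rval_rank\<close> such a real can be read off from its address, and only the
  addresses up to \<open>n\<close> are possible.\<close>

lemma finite_rank_le: "finite (rval ` {x \<in> seqs. unitr x \<and> rank x \<le> n})"
proof (rule finite_subset)
  show "rval ` {x \<in> seqs. unitr x \<and> rank x \<le> n} \<subseteq> (\<lambda>c. case prod_decode c of (j, i) \<Rightarrow> rval (en j i)) ` {..n}"
  proof safe
    fix x assume x: "x \<in> seqs" "unitr x" "rank x \<le> n"
    show "rval x \<in> (\<lambda>c. case prod_decode c of (j, i) \<Rightarrow> rval (en j i)) ` {..n}"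
      using rval_rank[OF x(1,2)] x(3) by (intro image_eqI[where x = "rank x - 1"]) (auto split: prod.splits)
  qed
qed simp

section \<open>Codes of functionals and their evaluation\<close>

text \<open>Codes are untyped and may contain arbitrary functions as oracles: \<open>Gc1\<close>
  expects an argument of type 1, \<open>Gc2\<close> one of type 1 and one of type 0. Only
  \<open>plot\<close> later selects the codes that denote objects of the model.\<close>

datatype cm = Num nat | Kk | Ss | Rr | Fn1 "nat \<Rightarrow> nat" | Fn2 "nat \<Rightarrow> nat \<Rightarrow> nat"
  | Gc1 "(nat \<Rightarrow> nat) \<Rightarrow> nat" | Gc2 "(nat \<Rightarrow> nat) \<Rightarrow> nat \<Rightarrow> nat" | Ap cm cm

text \<open>\<open>ev s args v\<close>: head reduction of \<open>s\<close>, applied to the arguments \<open>args\<close>, ends in the number \<open>v\<close>.\<close>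

inductive ev :: "cm \<Rightarrow> cm list \<Rightarrow> nat \<Rightarrow> bool" where
  ev_Num: "ev (Num n) [] n"
| ev_Ap: "ev a (b # args) v \<Longrightarrow> ev (Ap a b) args v"
| ev_Kk: "ev a args v \<Longrightarrow> ev Kk (a # b # args) v"
| ev_Ss: "ev a (c # Ap b c # args) v \<Longrightarrow> ev Ss (a # b # c # args) v"
| ev_Rr0: "ev n [] 0 \<Longrightarrow> ev m [] v \<Longrightarrow> ev Rr [f, m, n] v"
| ev_RrS: "ev n [] (Suc k) \<Longrightarrow> ev Rr [f, m, Num k] w \<Longrightarrow> ev f [Num k, Num w] v \<Longrightarrow> ev Rr [f, m, n] v"
| ev_Fn1: "ev a [] n \<Longrightarrow> ev (Fn1 f) [a] (f n)"
| ev_Fn2: "ev a [] m \<Longrightarrow> ev b [] n \<Longrightarrow> ev (Fn2 f) [a, b] (f m n)"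
| ev_Gc1: "\<forall>n. ev a [Num n] (f n) \<Longrightarrow> v = F f \<Longrightarrow> ev (Gc1 F) [a] v"
| ev_Gc2: "\<forall>n. ev a [Num n] (f n) \<Longrightarrow> ev b [] m \<Longrightarrow> v = F f m \<Longrightarrow> ev (Gc2 F) [a, b] v"

inductive_cases ev_NumE: "ev (Num n) args v"
inductive_cases ev_ApE: "ev (Ap a b) args v"
inductive_cases ev_KkE: "ev Kk (a # b # args) v"
inductive_cases ev_SsE: "ev Ss (a # b # c # args) v"
inductive_cases ev_RrE: "ev Rr [f, m, n] v"
inductive_cases ev_Fn1E: "ev (Fn1 f) [a] v"
inductive_cases ev_Fn2E: "ev (Fn2 f) [a, b] v"
inductive_cases ev_Gc1E: "ev (Gc1 F) [a] v"
inductive_cases ev_Gc2E: "ev (Gc2 F) [a, b] v"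

text \<open>The delicate rules are those for \<open>Gc1\<close> and \<open>Gc2\<close> with one
  premise for each number: the induction hypothesis fixes the argument at each number, hence as a
  sequence.\<close>

lemma ev_det: "ev s args v \<Longrightarrow> ev s args w \<Longrightarrow> v = w"
proof (induction arbitrary: w rule: ev.induct)
  case (ev_Num n)
  then show ?case by (auto elim: ev_NumE)
next
  case (ev_Ap a b args v)
  show ?case by (rule ev_ApE[OF ev_Ap.prems]) (rule ev_Ap.IH)
next
  case (ev_Kk a args v b)
  show ?case by (rule ev_KkE[OF ev_Kk.prems]) (rule ev_Kk.IH)
next
  case (ev_Ss a c b args v)
  show ?case by (rule ev_SsE[OF ev_Ss.prems]) (rule ev_Ss.IH)
next
  case (ev_Rr0 n m v f)
  from ev_Rr0.prems show ?case
    by (rule ev_RrE) (use ev_Rr0.IH in blast)+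
next
  case (ev_RrS n k f m w' v)
  from ev_RrS.prems show ?case
    by (rule ev_RrE) (use ev_RrS.IH in blast)+
next
  case (ev_Fn1 a n f)
  show ?case by (rule ev_Fn1E[OF ev_Fn1.prems]) (use ev_Fn1.IH in blast)
next
  case (ev_Fn2 a m b n f)
  show ?case by (rule ev_Fn2E[OF ev_Fn2.prems]) (use ev_Fn2.IH in blast)
next
  case (ev_Gc1 a f v F)
  from ev_Gc1.prems obtain g where g: "\<forall>n. ev a [Num n] (g n)" "w = F g"
    by (rule ev_Gc1E) (rule that)
  have "f = g"
    using ev_Gc1.IH g(1) by (intro ext) blast
  then show ?case using g(2) ev_Gc1.hyps by simp
next
  case (ev_Gc2 a f b m v F)
  from ev_Gc2.prems obtain g m' where g: "\<forall>n. ev a [Num n] (g n)" "ev b [] m'" "w = F g m'"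
    by (rule ev_Gc2E) (rule that)
  have "f = g"
    using ev_Gc2.IH(1) g(1) by (intro ext) blast
  moreover have "m = m'"
    using ev_Gc2.IH(2) g(2) by blast
  ultimately show ?case using g(3) ev_Gc2.hyps by simp
qed

lemma ev_unique: "ev s args v \<Longrightarrow> ev s args w \<longleftrightarrow> w = v"
  using ev_det by blast

lemma ev_simps [simp]:
  "ev (Num n) args v \<longleftrightarrow> args = [] \<and> v = n"
  "ev (Ap a b) args v \<longleftrightarrow> ev a (b # args) v"
  "ev Kk (a # b # args) v \<longleftrightarrow> ev a args v"
  "ev Ss (a # b # c # args) v \<longleftrightarrow> ev a (c # Ap b c # args) v"
  by (auto intro: ev.intros elim: ev_NumE ev_ApE ev_KkE ev_SsE)

lemma ev_Gc:
  "\<forall>n. ev a [Num n] (f n) \<Longrightarrow> ev (Gc1 F) [a] (F f)"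
  "\<forall>n. ev a [Num n] (f n) \<Longrightarrow> ev b [] m \<Longrightarrow> ev (Gc2 G) [a, b] (G f m)"
  by (auto intro: ev_Gc1 ev_Gc2)

text \<open>The induction must cover all codes \<open>a\<close> of \<open>n\<close>, because
  \<open>ev_RrS\<close> continues with a numeral in place of \<open>a\<close>.\<close>

lemma ev_rec:
  assumes "\<And>i c. ev f [Num i, Num c] (F i c)" "ev m [] k"
  shows "ev a [] n \<Longrightarrow> ev Rr [f, m, a] (rec_nat k F n)"
proof (induction n arbitrary: a)
  case 0
  then show ?case using ev_Rr0[OF 0 assms(2)] by simp
next
  case (Suc n)
  have "ev Rr [f, m, Num n] (rec_nat k F n)" by (rule Suc.IH) simp
  from ev_RrS[OF Suc.prems this assms(1)] show ?case by simp
qed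

text \<open>An equality without types, meant for redexes of \<open>Kk\<close> and \<open>Ss\<close>:
  these agree with their contracta on every argument list, so one argument serves all types.\<close>

definition eqv :: "cm \<Rightarrow> cm \<Rightarrow> bool" where
  "eqv s t \<longleftrightarrow> (\<forall>args v. ev s args v \<longleftrightarrow> ev t args v)"

lemma eqv_Ap: "eqv s t \<Longrightarrow> eqv (Ap s a) (Ap t a)"
  by (simp add: eqv_def)

section \<open>Plots\<close>

text \<open>
  A plot of type \<open>\<sigma>\<close> is a sequence of objects of type \<open>\<sigma>\<close> which exists in the model;
  \<open>plot \<sigma> u v\<close> says that \<open>u\<close> and \<open>v\<close> are plots with equal members. A functional is admitted
  to the model iff it maps plots to plots, which makes all types extensional.
\<close>

primrec plot :: "ty \<Rightarrow> (nat \<Rightarrow> cm) \<Rightarrow> (nat \<Rightarrow> cm) \<Rightarrow> bool" where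
  "plot T0 x y \<longleftrightarrow> (\<exists>f\<in>seqs. \<forall>n. ev (x n) [] (f n) \<and> ev (y n) [] (f n))"
| "plot (\<sigma> \<rightarrowtail> \<tau>) u v \<longleftrightarrow> (\<forall>r\<in>seqs. \<forall>x y. plot \<sigma> x y \<longrightarrow>
     plot \<tau> (\<lambda>n. Ap (u (r n)) (x n)) (\<lambda>n. Ap (v (r n)) (y n)))"

lemma plot_T0I:
  "f \<in> seqs \<Longrightarrow> (\<And>n. ev (x n) [] (f n)) \<Longrightarrow> (\<And>n. ev (y n) [] (f n)) \<Longrightarrow> plot T0 x y"
  by auto

lemma plot_FnI:
  "(\<And>r x y. r \<in> seqs \<Longrightarrow> plot \<sigma> x y \<Longrightarrow> plot \<tau> (\<lambda>n. Ap (u (r n)) (x n)) (\<lambda>n. Ap (v (r n)) (y n)))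
   \<Longrightarrow> plot (\<sigma> \<rightarrowtail> \<tau>) u v"
  by simp

definition rel :: "ty \<Rightarrow> cm \<Rightarrow> cm \<Rightarrow> bool" where
  "rel \<sigma> s t = plot \<sigma> (\<lambda>_. s) (\<lambda>_. t)"

lemma plot_eqv:
  "plot \<sigma> u v \<Longrightarrow> (\<And>n. eqv (u n) (u' n)) \<Longrightarrow> (\<And>n. eqv (v n) (v' n)) \<Longrightarrow> plot \<sigma> u' v'"
proof (induction \<sigma> arbitrary: u v u' v')
  case T0
  then show ?case by (auto simp: eqv_def)
next
  case (Fn \<sigma> \<tau>)
  show ?case
    unfolding plot.simps
  proof (intro ballI allI impI)
    fix r x y assume "r \<in> seqs" "plot \<sigma> x y"
    then have "plot \<tau> (\<lambda>n. Ap (u (r n)) (x n)) (\<lambda>n. Ap (v (r n)) (y n))"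
      using Fn.prems(1) by auto
    then show "plot \<tau> (\<lambda>n. Ap (u' (r n)) (x n)) (\<lambda>n. Ap (v' (r n)) (y n))"
      by (rule Fn.IH(2)) (simp_all add: eqv_Ap Fn.prems)
  qed
qed

text \<open>At arrow types the definition of \<open>plot\<close> already quantifies over
  reindexings, and two of them compose to one in \<open>seqs\<close>; at type 0 this is closure
  under composition.\<close>

lemma plot_reindex: "plot \<sigma> u v \<Longrightarrow> r \<in> seqs \<Longrightarrow> plot \<sigma> (\<lambda>n. u (r n)) (\<lambda>n. v (r n))"
proof (cases \<sigma>)
  case T0
  assume "plot \<sigma> u v" "r \<in> seqs"
  with T0 obtain f where f: "f \<in> seqs" "\<forall>n. ev (u n) [] (f n) \<and> ev (v n) [] (f n)" by auto
  then show ?thesis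
    using T0 seqs_comp[OF f(1) \<open>r \<in> seqs\<close>] by auto
next
  case (Fn \<sigma>1 \<sigma>2)
  assume *: "plot \<sigma> u v" "r \<in> seqs"
  show ?thesis
    unfolding Fn plot.simps
  proof (intro ballI allI impI)
    fix r' x y assume "r' \<in> seqs" "plot \<sigma>1 x y"
    then show "plot \<sigma>2 (\<lambda>n. Ap (u (r (r' n))) (x n)) (\<lambda>n. Ap (v (r (r' n))) (y n))"
      using * Fn seqs_comp[OF *(2), of r'] by auto
  qed
qed

lemma plot_rel: "plot \<sigma> u v \<Longrightarrow> rel \<sigma> (u n) (v n)"
  unfolding rel_def using plot_reindex[where r = "\<lambda>_. n"] seqs_simple(2) by blast

section \<open>Plots form a partial equivalence relation\<close>

lemma plot_sym: "plot \<sigma> u v \<Longrightarrow> plot \<sigma> v u"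
proof (induction \<sigma> arbitrary: u v)
  case T0
  then show ?case by auto
next
  case (Fn \<sigma> \<tau>)
  then show ?case unfolding plot.simps by blast
qed

lemma plot_trans: "plot \<sigma> u v \<Longrightarrow> plot \<sigma> v w \<Longrightarrow> plot \<sigma> u w"
proof (induction \<sigma> arbitrary: u v w)
  case T0
  then obtain f g where fg: "f \<in> seqs" "\<And>n. ev (u n) [] (f n) \<and> ev (v n) [] (f n)"
     "\<And>n. ev (v n) [] (g n) \<and> ev (w n) [] (g n)"
    by auto
  then have "f n = g n" for n using ev_det by blast
  then show ?case using fg by (intro plot_T0I[of f]) auto
next
  case (Fn \<sigma> \<tau>)
  show ?case
    unfolding plot.simps
  proof (intro ballI allI impI)
    fix r x y assume r: "r \<in> seqs" and xy: "plot \<sigma> x y"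
    have "plot \<sigma> y y" using Fn.IH(1)[OF plot_sym[OF xy] xy] .
    then have "plot \<tau> (\<lambda>n. Ap (v (r n)) (y n)) (\<lambda>n. Ap (w (r n)) (y n))"
      using Fn.prems(2) r unfolding plot.simps by blast
    moreover have "plot \<tau> (\<lambda>n. Ap (u (r n)) (x n)) (\<lambda>n. Ap (v (r n)) (y n))"
      using Fn.prems(1) r xy unfolding plot.simps by blast
    ultimately show "plot \<tau> (\<lambda>n. Ap (u (r n)) (x n)) (\<lambda>n. Ap (w (r n)) (y n))"
      by (rule Fn.IH(2)[rotated])
  qed
qed

lemma plot_refl: "plot \<sigma> u v \<Longrightarrow> plot \<sigma> u u" "plot \<sigma> u v \<Longrightarrow> plot \<sigma> v v"
  using plot_sym plot_trans by blast+

lemma plot_Ap: "plot (\<sigma> \<rightarrowtail> \<tau>) u v \<Longrightarrow> plot \<sigma> x y \<Longrightarrow> plot \<tau> (\<lambda>n. Ap (u n) (x n)) (\<lambda>n. Ap (v n) (y n))"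
  using seqs_simple(1) by auto

text \<open>Uniformity in \<open>n\<close> is a matter of \<open>u\<close> and \<open>v\<close>
  separately; once it is given, equality can be checked one member at a time. This is what yields
  extensionality in \<open>rel_ext\<close>.\<close>

lemma plot_pointwise: "plot \<sigma> u u \<Longrightarrow> plot \<sigma> v v \<Longrightarrow> (\<And>n. rel \<sigma> (u n) (v n)) \<Longrightarrow> plot \<sigma> u v"
proof (induction \<sigma> arbitrary: u v)
  case T0
  then obtain f g where fg: "f \<in> seqs" "\<And>n. ev (u n) [] (f n)" "\<And>n. ev (v n) [] (g n)"
    by auto
  have "f n = g n" for n
  proof -
    obtain k where "ev (u n) [] k" "ev (v n) [] k"
      using T0(3)[of n] by (auto simp: rel_def)
    then show ?thesis using fg ev_det by blast
  qed
  then show ?case using fg by (intro plot_T0I[of f]) auto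
next
  case (Fn \<sigma> \<tau>)
  show ?case
    unfolding plot.simps
  proof (intro ballI allI impI)
    fix r x y assume r: "r \<in> seqs" and xy: "plot \<sigma> x y"
    note app = plot_Ap[OF plot_reindex[OF Fn.prems(1) r] plot_refl(1)[OF xy]]
      plot_Ap[OF plot_reindex[OF Fn.prems(2) r] plot_refl(2)[OF xy]]
    show "plot \<tau> (\<lambda>n. Ap (u (r n)) (x n)) (\<lambda>n. Ap (v (r n)) (y n))"
    proof (rule Fn.IH(2)[OF app])
      fix n
      show "rel \<tau> (Ap (u (r n)) (x n)) (Ap (v (r n)) (y n))"
        using plot_Ap[OF Fn.prems(3)[of "r n", unfolded rel_def] plot_rel[OF xy, of n, unfolded rel_def]]
        by (simp add: rel_def)
    qed
  qed
qed

lemma rel_sym: "rel \<sigma> a b \<Longrightarrow> rel \<sigma> b a"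
  unfolding rel_def by (rule plot_sym)

lemma rel_trans: "rel \<sigma> a b \<Longrightarrow> rel \<sigma> b c \<Longrightarrow> rel \<sigma> a c"
  unfolding rel_def by (rule plot_trans)

lemma rel_refl: "rel \<sigma> a b \<Longrightarrow> rel \<sigma> a a" "rel \<sigma> a b \<Longrightarrow> rel \<sigma> b b"
  unfolding rel_def by (rule plot_refl, assumption)+

lemma rel_Ap: "rel (\<sigma> \<rightarrowtail> \<tau>) s t \<Longrightarrow> rel \<sigma> a b \<Longrightarrow> rel \<tau> (Ap s a) (Ap t b)"
  unfolding rel_def by (rule plot_Ap)

lemma rel_eqv: "rel \<sigma> s s \<Longrightarrow> eqv s t \<Longrightarrow> rel \<sigma> s t"
  unfolding rel_def by (erule plot_eqv) (auto simp: eqv_def)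

lemma rel_ext:
  assumes "rel (\<sigma> \<rightarrowtail> \<tau>) s s" "rel (\<sigma> \<rightarrowtail> \<tau>) t t" "\<And>a. rel \<sigma> a a \<Longrightarrow> rel \<tau> (Ap s a) (Ap t a)"
  shows "rel (\<sigma> \<rightarrowtail> \<tau>) s t"
  unfolding rel_def
proof (rule plot_FnI)
  fix r x y assume xy: "plot \<sigma> x y"
  show "plot \<tau> (\<lambda>n. Ap s (x n)) (\<lambda>n. Ap t (y n))"
  proof (rule plot_pointwise)
    show "plot \<tau> (\<lambda>n. Ap s (x n)) (\<lambda>n. Ap s (x n))" "plot \<tau> (\<lambda>n. Ap t (y n)) (\<lambda>n. Ap t (y n))"
      using plot_Ap[OF assms(1)[unfolded rel_def] plot_refl(1)[OF xy]]
        plot_Ap[OF assms(2)[unfolded rel_def] plot_refl(2)[OF xy]] by simp_all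
    fix n
    have "rel \<tau> (Ap s (x n)) (Ap s (y n))" "rel \<tau> (Ap s (y n)) (Ap t (y n))"
      using rel_Ap[OF assms(1) plot_rel[OF xy]] assms(3)[OF rel_refl(2)[OF plot_rel[OF xy]]] .
    then show "rel \<tau> (Ap s (x n)) (Ap t (y n))" by (rule rel_trans)
  qed
qed

section \<open>Numerals and sequences as plots\<close>

lemma plot_Num: "f \<in> seqs \<Longrightarrow> plot T0 (\<lambda>n. Num (f n)) (\<lambda>n. Num (f n))"
  by (intro plot_T0I[of f]) auto

lemma rel_T0: "rel T0 a b \<longleftrightarrow> (\<exists>n. ev a [] n \<and> ev b [] n)"
proof
  assume "\<exists>n. ev a [] n \<and> ev b [] n"
  then obtain n where "ev a [] n" "ev b [] n" by blast
  then show "rel T0 a b"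
    unfolding rel_def by (rule plot_T0I[OF seqs_simple(2)])
qed (auto simp: rel_def)

lemma rel_Num: "rel T0 (Num n) (Num n)"
  by (simp add: rel_T0)

lemma plot_Fn1:
  assumes "g \<in> seqs"
  shows "plot T1 (\<lambda>n. Fn1 (row n g)) (\<lambda>n. Fn1 (row n g))"
proof (intro plot_FnI)
  fix r x y assume r: "r \<in> seqs" and "plot T0 x y"
  then obtain f where f: "f \<in> seqs" "\<And>n. ev (x n) [] (f n)" "\<And>n. ev (y n) [] (f n)" by auto
  have "(\<lambda>n. row (r n) g (f n)) \<in> seqs"
    unfolding row_def by (intro seqs_comp[OF assms] seqs_binary r f)
  then show "plot T0 (\<lambda>n. Ap (Fn1 (row (r n) g)) (x n)) (\<lambda>n. Ap (Fn1 (row (r n) g)) (y n))"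
    by (rule plot_T0I) (simp_all add: ev_Fn1 f)
qed

text \<open>Together with \<open>plot_Fn1\<close> this identifies the plots of type 1 with the
  sequences of sequences coded by a member of \<open>seqs\<close>.\<close>

lemma plot_T1_normal:
  assumes "plot T1 u v"
  obtains g where "g \<in> seqs" "\<And>n m. ev (u n) [Num m] (row n g m)" "\<And>n m. ev (v n) [Num m] (row n g m)"
    "plot T1 u (\<lambda>n. Fn1 (row n g))"
proof -
  let ?fst = "\<lambda>n. fst (prod_decode n)" and ?snd = "\<lambda>n. snd (prod_decode n)"
  \<comment> \<open>Indexing by codes of pairs lists all values of all members in a single plot of
    numbers.\<close>
  have "plot T0 (\<lambda>n. Ap (u (?fst n)) (Num (?snd n))) (\<lambda>n. Ap (v (?fst n)) (Num (?snd n)))"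
    by (rule plot_Ap[OF plot_reindex[OF assms] plot_Num]) (rule seqs_simple)+
  then obtain g where g: "g \<in> seqs" "\<And>n. ev (u (?fst n)) [Num (?snd n)] (g n)"
     "\<And>n. ev (v (?fst n)) [Num (?snd n)] (g n)"
    by auto
  have uv: "ev (u n) [Num m] (row n g m)" "ev (v n) [Num m] (row n g m)" for n m
    using g(2,3)[of "prod_encode (n, m)"] by (simp_all add: row_def)
  have "plot T1 u (\<lambda>n. Fn1 (row n g))"
    unfolding plot.simps(2)
  proof (intro ballI allI impI)
    fix r x y assume r: "r \<in> seqs" and xy: "plot T0 x y"
    obtain f where f: "f \<in> seqs" "\<And>n. ev (x n) [] (f n)" "\<And>n. ev (y n) [] (f n)" using xy by auto
    \<comment> \<open>An argument \<open>x n\<close> need not be a numeral, whereas \<open>g\<close>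
      records values at numerals only; the members of \<open>u\<close> respect this
      replacement.\<close>
    have "plot T0 x (\<lambda>n. Num (f n))" using f by (intro plot_T0I[of f]) auto
    then have "plot T0 (\<lambda>n. Ap (u (r n)) (x n)) (\<lambda>n. Ap (u (r n)) (Num (f n)))"
      using plot_Ap[OF plot_reindex[OF plot_refl(1)[OF assms] r]] by blast
    then obtain h where h: "h \<in> seqs" "\<And>n. ev (u (r n)) [x n] (h n)" "\<And>n. ev (u (r n)) [Num (f n)] (h n)"
      by auto
    have "h n = row (r n) g (f n)" for n
      using ev_det h(3) uv(1) by blast
    then have "ev (Fn1 (row (r n) g)) [y n] (h n)" for n
      using ev_Fn1[OF f(3)] by simp
    then show "plot T0 (\<lambda>n. Ap (u (r n)) (x n)) (\<lambda>n. Ap (Fn1 (row (r n) g)) (y n))"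
      using h by (intro plot_T0I[of h]) auto
  qed
  then show ?thesis using that g uv by blast
qed

lemma rel_Fn1: "f \<in> seqs \<Longrightarrow> rel T1 (Fn1 f) (Fn1 f)"
  using plot_rel[OF plot_Fn1[of "consf f f"], of 0] seqs_binary(7)[of f f] by (simp add: row_consf)

lemma rel_T1_normal:
  assumes "rel T1 a a"
  obtains f where "f \<in> seqs" "rel T1 a (Fn1 f)"
proof -
  obtain g where "g \<in> seqs" "plot T1 (\<lambda>_. a) (\<lambda>n. Fn1 (row n g))"
    using plot_T1_normal[OF assms[unfolded rel_def]] .
  then show ?thesis
    using that[of "row 0 g"] seqs_row plot_rel by blast
qed

lemma rel_T0_normal:
  assumes "rel T0 a a"
  obtains n where "rel T0 a (Num n)"
  using assms by (auto simp: rel_T0)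

lemma plot_K: "plot (\<rho> \<rightarrowtail> \<tau> \<rightarrowtail> \<rho>) (\<lambda>_. Kk) (\<lambda>_. Kk)"
proof (intro plot_FnI)
  fix r x y r' x' y' assume "plot \<rho> x y" "r' \<in> seqs"
  then show "plot \<rho> (\<lambda>n. Ap (Ap Kk (x (r' n))) (x' n)) (\<lambda>n. Ap (Ap Kk (y (r' n))) (y' n))"
    by (rule plot_eqv[OF plot_reindex]) (simp_all add: eqv_def)
qed

lemma plot_S: "plot ((\<rho> \<rightarrowtail> \<sigma> \<rightarrowtail> \<tau>) \<rightarrowtail> (\<rho> \<rightarrowtail> \<sigma>) \<rightarrowtail> \<rho> \<rightarrowtail> \<tau>) (\<lambda>_. Ss) (\<lambda>_. Ss)"
proof (intro plot_FnI)
  fix r x x1 r' y y1 r'' z z1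
  assume x: "plot (\<rho> \<rightarrowtail> \<sigma> \<rightarrowtail> \<tau>) x x1" and r': "r' \<in> seqs" and y: "plot (\<rho> \<rightarrowtail> \<sigma>) y y1"
    and r'': "r'' \<in> seqs" and z: "plot \<rho> z z1"
  show "plot \<tau> (\<lambda>n. Ap (Ap (Ap Ss (x (r' (r'' n)))) (y (r'' n))) (z n))
     (\<lambda>n. Ap (Ap (Ap Ss (x1 (r' (r'' n)))) (y1 (r'' n))) (z1 n))"
    using plot_Ap[OF plot_Ap[OF plot_reindex[OF x seqs_comp[OF r' r'']] z] plot_Ap[OF plot_reindex[OF y r''] z]]
    by (rule plot_eqv) (simp_all add: eqv_def)
qed

lemma plot_Fn2:
  assumes "g \<in> seqs" "\<And>m n. f m n = g (prod_encode (m, n))"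
  shows "plot (T0 \<rightarrowtail> T0 \<rightarrowtail> T0) (\<lambda>_. Fn2 f) (\<lambda>_. Fn2 f)"
proof (intro plot_FnI)
  fix r x y r' x' y' assume "plot T0 x y" and r': "r' \<in> seqs" and "plot T0 x' y'"
  then obtain h h' where h: "h \<in> seqs" "\<And>n. ev (x n) [] (h n)" "\<And>n. ev (y n) [] (h n)"
    "h' \<in> seqs" "\<And>n. ev (x' n) [] (h' n)" "\<And>n. ev (y' n) [] (h' n)" by auto
  have "(\<lambda>n. f (h (r' n)) (h' n)) \<in> seqs"
    unfolding assms(2) by (intro seqs_comp[OF assms(1)] seqs_binary seqs_comp[OF h(1)] r' h)
  then show "plot T0 (\<lambda>n. Ap (Ap (Fn2 f) (x (r' n))) (x' n)) (\<lambda>n. Ap (Ap (Fn2 f) (y (r' n))) (y' n))"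
    by (rule plot_T0I) (simp_all add: ev_Fn2 h)
qed

lemma plot_R: "plot ((T0 \<rightarrowtail> T0 \<rightarrowtail> T0) \<rightarrowtail> T0 \<rightarrowtail> T0 \<rightarrowtail> T0) (\<lambda>_. Rr) (\<lambda>_. Rr)"
proof (intro plot_FnI)
  fix r r' r'' :: "nat \<Rightarrow> nat" and f f1 m m1 k k1
  assume f: "plot (T0 \<rightarrowtail> T0 \<rightarrowtail> T0) f f1" and r': "r' \<in> seqs" and m: "plot T0 m m1"
    and r'': "r'' \<in> seqs" and k: "plot T0 k k1"
  let ?fst = "\<lambda>n. fst (prod_decode n)" and ?snd = "\<lambda>n. snd (prod_decode n)"
  \<comment> \<open>The index packs \<open>n\<close>, \<open>i\<close> and \<open>c\<close>, so that
    one sequence records all step functions on numerals and \<open>seqs_rec\<close> can run all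
    recursions at once.\<close>
  let ?F = "\<lambda>f n. Ap (Ap (f (r' (r'' (?fst n)))) (Num (?fst (?snd n)))) (Num (?snd (?snd n)))"
  have "plot T0 (?F f) (?F f1)"
    by (intro plot_Ap[OF plot_Ap[OF plot_reindex[OF f, of "\<lambda>n. r' (r'' (?fst n))"]]]
        plot_Num seqs_comp[OF r'] seqs_comp[OF r''] seqs_projections seqs_simple)
  then obtain g where "g \<in> seqs" "\<And>n. ev (?F f n) [] (g n)" "\<And>n. ev (?F f1 n) [] (g n)" by auto
  then have g: "g \<in> seqs" "ev (f (r' (r'' n))) [Num i, Num c] (g (prod_encode (n, prod_encode (i, c))))"
    "ev (f1 (r' (r'' n))) [Num i, Num c] (g (prod_encode (n, prod_encode (i, c))))" for n i c
    by (simp_all, metis fst_conv prod_encode_inverse snd_conv, metis fst_conv prod_encode_inverse snd_conv)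
  obtain a where a: "a \<in> seqs" "\<And>n. ev (m n) [] (a n)" "\<And>n. ev (m1 n) [] (a n)" using m by auto
  obtain b where b: "b \<in> seqs" "\<And>n. ev (k n) [] (b n)" "\<And>n. ev (k1 n) [] (b n)" using k by auto
  have "(\<lambda>n. rec_nat (a (r'' n)) (\<lambda>i c. g (prod_encode (n, prod_encode (i, c)))) (b n)) \<in> seqs"
    by (rule seqs_rec[OF g(1) seqs_comp[OF a(1) r''] b(1)])
  then show "plot T0 (\<lambda>n. Ap (Ap (Ap Rr (f (r' (r'' n)))) (m (r'' n))) (k n))
       (\<lambda>n. Ap (Ap (Ap Rr (f1 (r' (r'' n)))) (m1 (r'' n))) (k1 n))"
    by (rule plot_T0I) (simp_all add: ev_rec[OF g(2) a(2) b(2)] ev_rec[OF g(3) a(3) b(3)])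
qed

text \<open>By \<open>plot_T1_normal\<close> a plot of arguments amounts to the rows of some
  \<open>g\<close> in \<open>seqs\<close>, so admission to the model reduces to a closure property
  of \<open>seqs\<close>.\<close>

lemma rel_Gc1:
  assumes "\<And>g. g \<in> seqs \<Longrightarrow> (\<lambda>n. F (row n g)) \<in> seqs"
  shows "rel T2 (Gc1 F) (Gc1 F)"
  unfolding rel_def
proof (intro plot_FnI)
  fix r x y assume "plot T1 x y"
  then obtain g where "g \<in> seqs" "\<And>n m. ev (x n) [Num m] (row n g m)" "\<And>n m. ev (y n) [Num m] (row n g m)"
    by (rule plot_T1_normal) (rule that)
  then show "plot T0 (\<lambda>n. Ap (Gc1 F) (x n)) (\<lambda>n. Ap (Gc1 F) (y n))"
    by (intro plot_T0I[OF assms[of g]]) (simp_all add: ev_Gc)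
qed

lemma rel_Gc2:
  assumes "\<And>g r f. g \<in> seqs \<Longrightarrow> r \<in> seqs \<Longrightarrow> f \<in> seqs \<Longrightarrow> (\<lambda>n. F (row (r n) g) (f n)) \<in> seqs"
  shows "rel (T1 \<rightarrowtail> T0 \<rightarrowtail> T0) (Gc2 F) (Gc2 F)"
  unfolding rel_def
proof (intro plot_FnI)
  fix r r' :: "nat \<Rightarrow> nat" and x y x' y'
  assume xy: "plot T1 x y" and r': "r' \<in> seqs" and "plot T0 x' y'"
  obtain g where g: "g \<in> seqs" "\<And>n m. ev (x n) [Num m] (row n g m)" "\<And>n m. ev (y n) [Num m] (row n g m)"
    by (rule plot_T1_normal[OF xy]) (rule that)
  obtain f where f: "f \<in> seqs" "\<And>n. ev (x' n) [] (f n)" "\<And>n. ev (y' n) [] (f n)"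
    using \<open>plot T0 x' y'\<close> by auto
  show "plot T0 (\<lambda>n. Ap (Ap (Gc2 F) (x (r' n))) (x' n)) (\<lambda>n. Ap (Ap (Gc2 F) (y (r' n))) (y' n))"
    by (intro plot_T0I[OF assms[OF g(1) r' f(1)]]) (simp_all add: ev_Gc g f)
qed

primrec default :: "ty \<Rightarrow> cm" where
  "default T0 = Num 0"
| "default (\<sigma> \<rightarrowtail> \<tau>) = Ap Kk (default \<tau>)"

lemma rel_default: "rel \<sigma> (default \<sigma>) (default \<sigma>)"
proof (induction \<sigma>)
  case T0
  then show ?case by (simp add: rel_Num)
next
  case (Fn \<sigma> \<tau>)
  then show ?case using rel_Ap[OF plot_K[of \<tau> \<sigma>, folded rel_def]] by simp
qed

section \<open>Satisfaction\<close>

type_synonym env = "var \<Rightarrow> cm"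

primrec tv :: "env \<Rightarrow> tm \<Rightarrow> cm" where
  "tv e (Var x) = e x"
| "tv e (s \<cdot> t) = Ap (tv e s) (tv e t)"
| "tv e Zero = Num 0"
| "tv e One = Num 1"
| "tv e Plus = Fn2 (+)"
| "tv e Times = Fn2 (*)"
| "tv e (Kc \<rho> \<tau>) = Kk"
| "tv e (Sc \<rho> \<sigma> \<tau>) = Ss"
| "tv e Rc = Rr"

primrec sat :: "fm \<Rightarrow> env \<Rightarrow> bool" where
  "sat (Eq s t) e \<longleftrightarrow> (\<exists>n. ev (tv e s) [] n \<and> ev (tv e t) [] n)"
| "sat (Less s t) e \<longleftrightarrow> (\<exists>m n. ev (tv e s) [] m \<and> ev (tv e t) [] n \<and> m < n)"
| "sat Falsum e \<longleftrightarrow> False"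
| "sat (Imp A B) e \<longleftrightarrow> (sat A e \<longrightarrow> sat B e)"
| "sat (All x A) e \<longleftrightarrow> (\<forall>a. rel (snd x) a a \<longrightarrow> sat A (e(x := a)))"

definition env_plot :: "(nat \<Rightarrow> env) \<Rightarrow> (nat \<Rightarrow> env) \<Rightarrow> bool" where
  "env_plot \<epsilon> \<epsilon>' \<longleftrightarrow> (\<forall>x. plot (snd x) (\<lambda>n. \<epsilon> n x) (\<lambda>n. \<epsilon>' n x))"

definition env_rel :: "env \<Rightarrow> env \<Rightarrow> bool" where
  "env_rel e e' \<longleftrightarrow> (\<forall>x. rel (snd x) (e x) (e' x))"

text \<open>All constants are plots and application preserves plots. Sequences of environments,
  rather than single ones, are considered for the sake of \<open>seqs_sat_qf\<close>.\<close>

lemma plot_tv: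
  assumes "env_plot \<epsilon> \<epsilon>'"
  shows "wt t \<Longrightarrow> plot (type_of t) (\<lambda>n. tv (\<epsilon> n) t) (\<lambda>n. tv (\<epsilon>' n) t)"
proof (induction t)
  case (Var x)
  then show ?case using assms by (simp add: env_plot_def del: split_paired_All)
next
  case (App s t)
  then obtain \<tau> where "type_of s = type_of t \<rightarrowtail> \<tau>" by auto
  then show ?case using App plot_Ap by auto
next
  case Plus
  have "plot (T0 \<rightarrowtail> T0 \<rightarrowtail> T0) (\<lambda>_. Fn2 (+)) (\<lambda>_. Fn2 (+))"
    by (rule plot_Fn2[OF seqs_binary(2)[OF seqs_simple(3,4)]]) simp
  then show ?case by (simp del: plot.simps)
next
  case Times
  have "plot (T0 \<rightarrowtail> T0 \<rightarrowtail> T0) (\<lambda>_. Fn2 (*)) (\<lambda>_. Fn2 (*))"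
    by (rule plot_Fn2[OF seqs_binary(3)[OF seqs_simple(3,4)]]) simp
  then show ?case by (simp del: plot.simps)
qed (use rel_Num[unfolded rel_def] plot_K plot_S plot_R in \<open>simp_all del: plot.simps\<close>)

lemma rel_tv: "env_rel e e' \<Longrightarrow> wt t \<Longrightarrow> rel (type_of t) (tv e t) (tv e' t)"
  unfolding rel_def by (rule plot_tv) (simp_all add: env_plot_def env_rel_def rel_def del: split_paired_All)

lemma tv_cong: "(\<And>x. x \<in> fvt t \<Longrightarrow> e x = e' x) \<Longrightarrow> tv e t = tv e' t"
  by (induction t) auto

lemma sat_cong: "(\<And>x. x \<in> fv A \<Longrightarrow> e x = e' x) \<Longrightarrow> sat A e = sat A e'"
proof (induction A arbitrary: e e')
  case (Eq s t)
  then show ?case using tv_cong[of s e e'] tv_cong[of t e e'] by simp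
next
  case (Less s t)
  then show ?case using tv_cong[of s e e'] tv_cong[of t e e'] by simp
next
  case (Imp A B)
  from Imp.IH[of e e'] Imp.prems show ?case by simp
next
  case (All x A)
  have "sat A (e(x := a)) = sat A (e'(x := a))" for a
    by (rule All.IH) (use All.prems in auto)
  then show ?case by simp
qed simp

lemma tv_substt: "tv e (substt x u t) = tv (e(x := tv e u)) t"
  by (induction t) auto

lemma substt_fresh: "x \<notin> fvt t \<Longrightarrow> substt x u t = t"
  by (induction t) auto

lemma subst_fresh: "x \<notin> fv A \<Longrightarrow> subst x u A = A"
  by (induction A) (auto simp: substt_fresh)

lemma sat_subst: "free_for u x A \<Longrightarrow> sat (subst x u A) e = sat A (e(x := tv e u))"
proof (induction A arbitrary: e)
  case (All y A)
  show ?case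
  proof (cases "x \<in> fv (All y A)")
    case False
    then show ?thesis
      using subst_fresh[OF False] sat_cong[of "All y A" "e(x := tv e u)" e] by (metis fun_upd_other)
  next
    case True
    then have *: "y \<notin> fvt u" "free_for u x A" "x \<noteq> y" using All.prems by auto
    have IH: "sat (subst x u A) (e(y := a)) = sat A ((e(x := tv e u))(y := a))" for a
      using All.IH[OF *(2), of "e(y := a)"] *(1,3) tv_cong[of u "e(y := a)" e]
      by (metis fun_upd_other fun_upd_twist)
    show ?thesis by (simp only: subst.simps *(3) if_False sat.simps IH)
  qed
qed (auto simp: tv_substt)

lemma env_rel_upd: "env_rel e e' \<Longrightarrow> rel (snd x) a b \<Longrightarrow> env_rel (e(x := a)) (e'(x := b))"
  by (simp add: env_rel_def del: split_paired_All)

text \<open>Atoms compare numbers only, and equal objects yield the same numbers. This permits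
  replacing an object by its normal form inside any formula.\<close>

lemma sat_env_rel: "env_rel e e' \<Longrightarrow> wff A \<Longrightarrow> sat A e = sat A e'"
proof (induction A arbitrary: e e')
  case (Eq s t)
  then show ?case using rel_tv[of e e' s] rel_tv[of e e' t] by (auto simp: rel_T0) (metis ev_det)+
next
  case (Less s t)
  then show ?case using rel_tv[of e e' s] rel_tv[of e e' t] by (auto simp: rel_T0) (metis ev_det)+
next
  case (Imp A B)
  from Imp.IH[OF Imp.prems(1)] Imp.prems(2) show ?case by simp
next
  case (All x A)
  have "rel (snd x) a a \<Longrightarrow> sat A (e(x := a)) = sat A (e'(x := a))" for a
    by (rule All.IH[OF env_rel_upd[OF All.prems(1)]]) (use All.prems(2) in auto)
  then show ?case by simp
qed simp

lemma soundness:
  assumes "T \<turnstile> A" "\<And>B e. B \<in> T \<Longrightarrow> wff B \<Longrightarrow> env_rel e e \<Longrightarrow> sat B e" "env_rel e e"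
  shows "sat A e"
  using assms(1,3)
proof (induction arbitrary: e rule: provable.induct)
  case (ax A)
  then show ?case using assms(2) by blast
next
  case (inst A t x)
  have "rel (snd x) (tv e t) (tv e t)"
    using rel_tv[OF inst.prems inst.hyps(2)] inst.hyps(3) by simp
  then show ?case using sat_subst[OF inst.hyps(4)] by auto
next
  case (dist A B x)
  have "sat A (e(x := a)) = sat A e" for a
    by (rule sat_cong) (use dist.hyps(3) in auto)
  then show ?case by auto
next
  case (refl t)
  then show ?case using rel_tv[of e e t] by (auto simp: rel_T0)
next
  case (leibniz A s t x)
  show ?case
  proof (simp only: sat.simps(4), intro impI)
    assume "sat (Eq s t) e" "sat (subst x s A) e"
    then have "env_rel (e(x := tv e s)) (e(x := tv e t))"
      using leibniz.hyps(3) by (intro env_rel_upd[OF leibniz.prems]) (simp add: rel_T0)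
    then have "sat A (e(x := tv e s)) = sat A (e(x := tv e t))"
      using leibniz.hyps(1) by (rule sat_env_rel)
    then show "sat (subst x t A) e"
      using \<open>sat (subst x s A) e\<close> sat_subst[OF leibniz.hyps(4)] sat_subst[OF leibniz.hyps(5)] by blast
  qed
next
  case (gen A x)
  show ?case
    unfolding sat.simps using gen.IH env_rel_upd[OF gen.prems] by blast
qed auto

text \<open>Each object of type 0 or 1 is equal in the model to a numeral or to some
  \<open>Fn1 f\<close> with \<open>f\<close> in \<open>seqs\<close>, and satisfaction respects this
  equality. Hence the numbers of the model are standard and its sequences are those in
  \<open>seqs\<close>.\<close>

lemma sat_All_normal:
  assumes "env_rel e e" "wff A"
  shows "sat (All (i, T0) A) e \<longleftrightarrow> (\<forall>n. sat A (e((i, T0) := Num n)))"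
    "sat (All (i, T1) A) e \<longleftrightarrow> (\<forall>f\<in>seqs. sat A (e((i, T1) := Fn1 f)))"
proof -
  have *: "rel \<sigma> a b \<Longrightarrow> sat A (e((i, \<sigma>) := a)) = sat A (e((i, \<sigma>) := b))" for a b \<sigma>
    using assms by (intro sat_env_rel env_rel_upd) auto
  have **: "sat (All (i, \<sigma>) A) e"
    if "\<And>a. rel \<sigma> a a \<Longrightarrow> \<exists>b. rel \<sigma> a b \<and> sat A (e((i, \<sigma>) := b))" for \<sigma>
    using that * by (metis sat.simps(5) snd_conv)
  show "sat (All (i, T0) A) e \<longleftrightarrow> (\<forall>n. sat A (e((i, T0) := Num n)))"
  proof
    assume "\<forall>n. sat A (e((i, T0) := Num n))"
    then show "sat (All (i, T0) A) e"
      by (intro **) (metis rel_T0_normal)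
  qed (simp add: rel_Num)
  show "sat (All (i, T1) A) e \<longleftrightarrow> (\<forall>f\<in>seqs. sat A (e((i, T1) := Fn1 f)))"
  proof
    assume "\<forall>f\<in>seqs. sat A (e((i, T1) := Fn1 f))"
    then show "sat (All (i, T1) A) e"
      by (intro **) (metis rel_T1_normal)
  qed (simp add: rel_Fn1)
qed

text \<open>Whatever types occur in its terms, an atom compares two plots of numbers, and the
  connectives are closure operations of \<open>seqs\<close>. The choice functional in
  \<open>sat_QF_AC\<close> minimizes over these truth values.\<close>

lemma seqs_sat_qf:
  assumes "env_plot \<epsilon> \<epsilon>"
  shows "qf A \<Longrightarrow> wff A \<Longrightarrow> (\<lambda>n. of_bool (sat A (\<epsilon> n)) :: nat) \<in> seqs"
proof (induction A)
  case (Eq s t)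
  then obtain f g where fg: "f \<in> seqs" "\<And>n. ev (tv (\<epsilon> n) s) [] (f n)" "g \<in> seqs" "\<And>n. ev (tv (\<epsilon> n) t) [] (g n)"
    using plot_tv[OF assms, of s] plot_tv[OF assms, of t] by auto
  then have "sat (Eq s t) (\<epsilon> n) \<longleftrightarrow> f n = g n" for n
    by (simp add: ev_unique[OF fg(2)] ev_unique[OF fg(4)])
  then show ?case using seqs_binary(4)[OF fg(1,3)] by presburger
next
  case (Less s t)
  then obtain f g where fg: "f \<in> seqs" "\<And>n. ev (tv (\<epsilon> n) s) [] (f n)" "g \<in> seqs" "\<And>n. ev (tv (\<epsilon> n) t) [] (g n)"
    using plot_tv[OF assms, of s] plot_tv[OF assms, of t] by auto
  then have "sat (Less s t) (\<epsilon> n) \<longleftrightarrow> f n < g n" for n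
    by (simp add: ev_unique[OF fg(2)] ev_unique[OF fg(4)])
  then show ?case using seqs_binary(5)[OF fg(1,3)] by presburger
next
  case (Imp A B)
  have "of_bool P = (1 :: nat) \<longleftrightarrow> P" for P
    by simp
  with seqs_binary(6)[OF Imp.IH] Imp.prems show ?case by simp
qed (use seqs_simple(2)[of 0] in simp_all)

section \<open>Reading formulas in the model\<close>

lemma ev_base_simps [simp]:
  "ev (Fn1 f) [a] v \<longleftrightarrow> (\<exists>n. ev a [] n \<and> v = f n)"
  "ev (Fn2 g) [a, b] v \<longleftrightarrow> (\<exists>m n. ev a [] m \<and> ev b [] n \<and> v = g m n)"
  by (blast intro: ev_Fn1 ev_Fn2 elim: ev_Fn1E ev_Fn2E)+

lemma ev_Gc_simps [simp]:
  "ev (Gc1 F) [Fn1 f] v \<longleftrightarrow> v = F f"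
  "ev (Gc2 G) [Fn1 f, Num n] v \<longleftrightarrow> v = G f n"
  using ev_unique[OF ev_Gc(1)[of "Fn1 f" f F]] ev_unique[OF ev_Gc(2)[of "Fn1 f" f "Num n" n G]]
  by simp_all

lemma ev_Pow2: "ev (tv e Pow2) [Num n] v \<longleftrightarrow> v = 2 ^ n"
proof -
  have "rec_nat 1 (\<lambda>i c. c + c) n = (2 :: nat) ^ n"
    by (induction n) simp_all
  moreover have "ev (tv e Pow2) [Num n] (rec_nat 1 (\<lambda>i c. c + c) n)"
    by (simp add: Pow2_def Let_def addt_def) (rule ev_rec, simp_all)
  ultimately show ?thesis using ev_unique by metis
qed

lemma ev_Bar: "ev (tv e Bar) [Fn1 f, Num n] v \<longleftrightarrow> v = barv f n"
proof -
  have "rec_nat 0 (\<lambda>i c. pairv c (f i) + 1) n = barv f n"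
    by (induction n) simp_all
  moreover have "ev (tv e Bar) [Fn1 f, Num n] (rec_nat 0 (\<lambda>i c. pairv c (f i) + 1) n)"
    by (simp add: Bar_def Let_def addt_def pair_def mult_def) (rule ev_rec, simp_all add: pairv_def)
  ultimately show ?thesis using ev_unique by metis
qed

lemma env_rel_updI: "env_rel e e \<Longrightarrow> rel (snd x) a a \<Longrightarrow> env_rel (e(x := a)) (e(x := a))"
  by (rule env_rel_upd)

lemma sat_connectives:
  "sat ((F \<^bold>\<and> G) d) e \<longleftrightarrow> sat (F d) e \<and> sat (G d) e"
  "sat ((F \<^bold>\<or> G) d) e \<longleftrightarrow> sat (F d) e \<or> sat (G d) e"
  "sat ((F \<^bold>\<longrightarrow> G) d) e \<longleftrightarrow> (sat (F d) e \<longrightarrow> sat (G d) e)"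
  "sat ((F \<^bold>\<longleftrightarrow> G) d) e \<longleftrightarrow> (sat (F d) e \<longleftrightarrow> sat (G d) e)"
  "sat ((\<^bold>\<not> F) d) e \<longleftrightarrow> \<not> sat (F d) e"
  by (auto simp: sfm_defs)

lemma sat_atoms:
  "sat ((s \<^bold>= t) d) e \<longleftrightarrow> (\<exists>n. ev (tv e s) [] n \<and> ev (tv e t) [] n)"
  "sat ((s \<^bold>< t) d) e \<longleftrightarrow> (\<exists>m n. ev (tv e s) [] m \<and> ev (tv e t) [] n \<and> m < n)"
  by (simp_all add: seq_def sless_def)

lemma sat_sall: "sat (sall \<sigma> F d) e \<longleftrightarrow> (\<forall>a. rel \<sigma> a a \<longrightarrow> sat (F (Var (d, \<sigma>)) (Suc d)) (e((d, \<sigma>) := a)))"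
  by (simp add: sall_def)

lemma sat_sex: "sat (sex \<sigma> F d) e \<longleftrightarrow> (\<exists>a. rel \<sigma> a a \<and> sat (F (Var (d, \<sigma>)) (Suc d)) (e((d, \<sigma>) := a)))"
  by (simp add: sex_def)

lemma sat_quantifiers:
  assumes "env_rel e e"
  shows "wff (F (Var (d, T0)) (Suc d)) \<Longrightarrow>
      sat (sall T0 F d) e \<longleftrightarrow> (\<forall>n. sat (F (Var (d, T0)) (Suc d)) (e((d, T0) := Num n)))"
    "wff (F (Var (d, T0)) (Suc d)) \<Longrightarrow>
      sat (sex T0 F d) e \<longleftrightarrow> (\<exists>n. sat (F (Var (d, T0)) (Suc d)) (e((d, T0) := Num n)))"
    "wff (F (Var (d, T1)) (Suc d)) \<Longrightarrow>
      sat (sall T1 F d) e \<longleftrightarrow> (\<forall>f. f \<in> seqs \<longrightarrow> sat (F (Var (d, T1)) (Suc d)) (e((d, T1) := Fn1 f)))"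
    "wff (F (Var (d, T1)) (Suc d)) \<Longrightarrow>
      sat (sex T1 F d) e \<longleftrightarrow> (\<exists>f. f \<in> seqs \<and> sat (F (Var (d, T1)) (Suc d)) (e((d, T1) := Fn1 f)))"
  unfolding sall_def sex_def
  using sat_All_normal(1)[OF assms] sat_All_normal(2)[OF assms]
    sat_All_normal(1)[OF assms, where A = "Neg (F (Var (d, T0)) (Suc d))"]
    sat_All_normal(2)[OF assms, where A = "Neg (F (Var (d, T1)) (Suc d))"]
  by (auto simp del: sat.simps(5))

section \<open>Free variables under binders, equality and projective normal forms\<close>

definition fresh :: "nat \<Rightarrow> tm \<Rightarrow> bool" where
  "fresh d t \<longleftrightarrow> (\<forall>x\<in>fvt t. fst x < d)"

lemma fresh_simps [simp]:
  "fresh d (Var x) \<longleftrightarrow> fst x < d"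
  "fresh d (s \<cdot> t) \<longleftrightarrow> fresh d s \<and> fresh d t"
  "fresh d Zero" "fresh d One" "fresh d Plus" "fresh d Times"
  "fresh d (Kc \<rho> \<tau>)" "fresh d (Sc \<rho> \<sigma> \<tau>)" "fresh d Rc"
  by (auto simp: fresh_def)

lemma fresh_Suc [simp]: "fresh d t \<Longrightarrow> fresh (Suc d) t"
  by (auto simp: fresh_def)

lemma tv_upd: "fresh d t \<Longrightarrow> d \<le> k \<Longrightarrow> tv (e((k, \<sigma>) := a)) t = tv e t"
  by (rule tv_cong) (auto simp: fresh_def)

lemma map_tv_upd: "\<forall>g\<in>set gs. fresh d g \<and> P g \<Longrightarrow> map (tv (e((d, \<sigma>) := a))) gs = map (tv e) gs"
  using tv_upd[OF _ order_refl] by auto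

text \<open>Induction on the type, where \<open>rel_ext\<close> leads from equality at all arguments
  back to \<open>rel\<close>. The extensionality axioms thereby reduce to
  \<open>rel_Ap\<close>.\<close>

lemma sat_eqT:
  "wt s \<Longrightarrow> wt t \<Longrightarrow> type_of s = \<sigma> \<Longrightarrow> type_of t = \<sigma> \<Longrightarrow> fresh d s \<Longrightarrow> fresh d t \<Longrightarrow> env_rel e e \<Longrightarrow>
   sat (eqT \<sigma> s t d) e \<longleftrightarrow> rel \<sigma> (tv e s) (tv e t)"
proof (induction \<sigma> arbitrary: s t d e)
  case T0
  then show ?case by (simp add: sat_atoms rel_T0)
next
  case (Fn \<sigma> \<tau>)
  have "sat (eqT \<tau> (s \<cdot> Var (d, \<sigma>)) (t \<cdot> Var (d, \<sigma>)) (Suc d)) (e((d, \<sigma>) := a)) \<longleftrightarrow>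
      rel \<tau> (Ap (tv e s) a) (Ap (tv e t) a)" if "rel \<sigma> a a" for a
    using Fn.prems that
    by (subst Fn.IH(2)) (simp_all add: env_rel_updI tv_upd[OF \<open>fresh d s\<close>] tv_upd[OF \<open>fresh d t\<close>])
  then have "sat (eqT (\<sigma> \<rightarrowtail> \<tau>) s t d) e \<longleftrightarrow> (\<forall>a. rel \<sigma> a a \<longrightarrow> rel \<tau> (Ap (tv e s) a) (Ap (tv e t) a))"
    by (simp add: sat_sall)
  moreover have "rel (\<sigma> \<rightarrowtail> \<tau>) (tv e s) (tv e s)" "rel (\<sigma> \<rightarrowtail> \<tau>) (tv e t) (tv e t)"
    using rel_tv[OF Fn.prems(7)] Fn.prems by metis+
  ultimately show ?case
    using rel_ext rel_Ap by blast
qed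

lemma sat_bars:
  assumes "map (tv e) gs = map Fn1 \<gamma>s" "tv e n = Num k"
  shows "ev (tv e (bars gs n)) [] v \<longleftrightarrow> v = barsv \<gamma>s k"
proof -
  have bar: "ev (tv e (bar g n)) [] v \<longleftrightarrow> v = barv f k" if "tv e g = Fn1 f" for g f v
    using that assms(2) by (simp add: bar_def ev_Bar)
  have fold: "ev (tv e (foldl (\<lambda>c h. pair c (bar h n)) c gs)) [] v \<longleftrightarrow> v = foldl (\<lambda>c h. pairv c (barv h k)) c' \<gamma>s"
    if "\<And>v. ev (tv e c) [] v \<longleftrightarrow> v = c'" "map (tv e) gs = map Fn1 \<gamma>s" for c c' gs \<gamma>s
    using that
  proof (induction gs arbitrary: \<gamma>s c c')
    case (Cons g gs)
    then obtain f fs where \<gamma>s: "\<gamma>s = f # fs" "tv e g = Fn1 f" "map (tv e) gs = map Fn1 fs"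
      by (cases \<gamma>s) auto
    have "ev (tv e (pair c (bar g n))) [] v \<longleftrightarrow> v = pairv c' (barv f k)" for v
      using Cons.prems(1) bar[OF \<gamma>s(2)] by (simp add: pair_def pairv_def addt_def mult_def)
    from Cons.IH[OF this \<gamma>s(3)] show ?case by (simp add: \<gamma>s(1))
  qed simp
  show ?thesis
  proof (cases gs)
    case Nil
    then show ?thesis using assms by simp
  next
    case (Cons g gs')
    then obtain f fs where \<gamma>s: "\<gamma>s = f # fs" "tv e g = Fn1 f" "map (tv e) gs' = map Fn1 fs"
      using assms(1) by (cases \<gamma>s) auto
    from fold[OF bar[OF this(2)] this(3)] show ?thesis by (simp add: Cons \<gamma>s(1))
  qed
qed

text \<open>The formula quantifies over \<open>seqs\<close> and the truth predicate over all
  sequences; each function quantifier is bridged by a Skolem function, existential ones by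
  \<open>seqs_skolem_S\<close> and universal ones by \<open>seqs_skolem_P\<close>.\<close>

lemma sat_NF:
  assumes "wt f" "type_of f = T1" "\<phi> \<in> seqs"
  shows "fresh d f \<Longrightarrow> \<forall>g\<in>set gs. fresh d g \<and> wt g \<and> type_of g = T1 \<Longrightarrow> env_rel e e \<Longrightarrow>
      tv e f = Fn1 \<phi> \<Longrightarrow> map (tv e) gs = map Fn1 \<gamma>s \<Longrightarrow> set \<gamma>s \<subseteq> seqs \<Longrightarrow>
      sat (SigmaNF k f gs d) e \<longleftrightarrow> trS k \<phi> \<gamma>s"
    "fresh d f \<Longrightarrow> \<forall>g\<in>set gs. fresh d g \<and> wt g \<and> type_of g = T1 \<Longrightarrow> env_rel e e \<Longrightarrow>
      tv e f = Fn1 \<phi> \<Longrightarrow> map (tv e) gs = map Fn1 \<gamma>s \<Longrightarrow> set \<gamma>s \<subseteq> seqs \<Longrightarrow>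
      sat (PiNF k f gs d) e \<longleftrightarrow> trP k \<phi> \<gamma>s"
proof (induction k arbitrary: gs \<gamma>s d e)
  case 0
  {
    case 1
    have *: "map (tv (e((d, T0) := Num n))) gs = map Fn1 \<gamma>s" for n
      using 1 by (simp add: map_tv_upd)
    show ?case
      using 1 assms sat_bars[OF *, where n = "Var (d, T0)"]
      by (simp add: sat_quantifiers wff_connectives wt_bars sat_atoms tv_upd[OF 1(1)])
  next
    case 2
    have *: "map (tv (e((d, T0) := Num n))) gs = map Fn1 \<gamma>s" for n
      using 2 by (simp add: map_tv_upd)
    show ?case
      using 2 assms sat_bars[OF *, where n = "Var (d, T0)"]
      by (simp add: sat_quantifiers wff_connectives wt_bars sat_atoms tv_upd[OF 2(1)])
  }
next
  case (Suc k)
  have upd: "map (tv (e((d, T1) := Fn1 g))) (gs @ [Var (d, T1)]) = map Fn1 (\<gamma>s @ [g])"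
    if "\<forall>g\<in>set gs. fresh d g \<and> wt g \<and> type_of g = T1" "map (tv e) gs = map Fn1 \<gamma>s" for e d gs \<gamma>s g
    using that by (simp add: map_tv_upd)
  {
    case 1
    have "sat (PiNF k f (gs @ [Var (d, T1)]) (Suc d)) (e((d, T1) := Fn1 g)) \<longleftrightarrow> trP k \<phi> (\<gamma>s @ [g])"
      if "g \<in> seqs" for g
      using 1 that upd[OF 1(2,5)]
      by (subst Suc.IH(2)[where e = "e((d, T1) := Fn1 g)"]) (simp_all add: env_rel_updI rel_Fn1 tv_upd[OF 1(1)] ball_Un)
    moreover have "wff (PiNF k f (gs @ [Var (d, T1)]) (Suc d))"
      using 1 assms by (intro wff_NF) auto
    ultimately show ?case
      using seqs_skolem_S[OF assms(3) 1(6)] by (simp add: sat_quantifiers 1(3) cong: conj_cong) blast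
  next
    case 2
    have "sat (SigmaNF k f (gs @ [Var (d, T1)]) (Suc d)) (e((d, T1) := Fn1 g)) \<longleftrightarrow> trS k \<phi> (\<gamma>s @ [g])"
      if "g \<in> seqs" for g
      using 2 that upd[OF 2(2,5)]
      by (subst Suc.IH(1)[where e = "e((d, T1) := Fn1 g)"]) (simp_all add: env_rel_updI rel_Fn1 tv_upd[OF 2(1)] ball_Un)
    moreover have "wff (SigmaNF k f (gs @ [Var (d, T1)]) (Suc d))"
      using 2 assms by (intro wff_NF) auto
    ultimately show ?case
      using seqs_skolem_P[OF assms(3) 2(6)] by (simp add: sat_quantifiers 2(3)) blast
  }
qed

section \<open>The axioms hold in the model\<close>

lemmas reading_simps = sentence_def sat_connectives sat_atoms sat_quantifiers wff_connectives
  wt_arith env_rel_updI rel_Num rel_Fn1 addt_def mult_def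

lemma sat_semiring:
  assumes "env_rel e e" "A \<in> semiring_axioms"
  shows "sat A e"
  using assms(2) unfolding semiring_axioms_def
  apply (simp only: image_insert image_empty insert_iff empty_iff)
  by (elim disjE FalseE; hypsubst) (simp_all add: reading_simps assms(1) algebra_simps, presburger+)

lemma sat_combinator:
  assumes "env_rel e e" "A \<in> combinator_axioms"
  shows "sat A e"
proof -
  consider (K) \<rho> \<tau> where "A = sentence (\<^bold>\<forall>x\<^bold>:\<rho>\<^bold>. \<^bold>\<forall>y\<^bold>:\<tau>\<^bold>. eqT \<rho> (Kc \<rho> \<tau> \<cdot> x \<cdot> y) x)"
    | (S) \<rho> \<sigma> \<tau> where "A = sentence (\<^bold>\<forall>x\<^bold>:\<rho> \<rightarrowtail> \<sigma> \<rightarrowtail> \<tau>\<^bold>. \<^bold>\<forall>y\<^bold>:\<rho> \<rightarrowtail> \<sigma>\<^bold>. \<^bold>\<forall>z\<^bold>:\<rho>\<^bold>.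
        eqT \<tau> (Sc \<rho> \<sigma> \<tau> \<cdot> x \<cdot> y \<cdot> z) (x \<cdot> z \<cdot> (y \<cdot> z)))"
    using assms(2) unfolding combinator_axioms_def by blast
  then show ?thesis
  proof cases
    case K
    have "rel \<rho> (Ap (Ap Kk a) b) a" if "rel \<rho> a a" for a b
      by (rule rel_sym[OF rel_eqv[OF that]]) (simp add: eqv_def)
    then show ?thesis
      unfolding K by (simp add: sentence_def sat_sall sat_eqT env_rel_updI assms(1))
  next
    case S
    have "rel \<tau> (Ap (Ap (Ap Ss a) b) c) (Ap (Ap a c) (Ap b c))"
      if "rel (\<rho> \<rightarrowtail> \<sigma> \<rightarrowtail> \<tau>) a a" "rel (\<rho> \<rightarrowtail> \<sigma>) b b" "rel \<rho> c c" for a b c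
      by (rule rel_sym[OF rel_eqv[OF rel_Ap[OF rel_Ap[OF that(1,3)] rel_Ap[OF that(2,3)]]]]) (simp add: eqv_def)
    then show ?thesis
      unfolding S by (simp add: sentence_def sat_sall sat_eqT env_rel_updI assms(1))
  qed
qed

lemma sat_recursor:
  assumes "env_rel e e" "A \<in> recursor_axioms"
  shows "sat A e"
proof -
  let ?R = "T0 \<rightarrowtail> T0 \<rightarrowtail> T0"
  have zero: "ev Rr [f, Num m, Num 0] m" for f m
    by (rule ev_Rr0) simp_all
  have suc: "\<exists>v. ev Rr [f, Num m, Ap (Ap (Fn2 (+)) (Num n)) (Num 1)] v \<and> ev f [Num n, Ap (Ap (Ap Rr f) (Num m)) (Num n)] v"
    if f: "rel ?R f f" for f m n
  proof -
    have R: "rel T0 (Ap (Ap (Ap Rr f) (Num m)) (Num n)) (Ap (Ap (Ap Rr f) (Num m)) (Num n))"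
      using rel_Ap[OF rel_Ap[OF rel_Ap[OF plot_R[folded rel_def] f] rel_Num] rel_Num] .
    then obtain w where w: "ev Rr [f, Num m, Num n] w"
      by (auto simp: rel_T0)
    \<comment> \<open>Evaluation passes the computed numeral \<open>w\<close> to \<open>f\<close>,
      but the axiom passes the recursion term itself; since \<open>f\<close> is an object of the
      model, it cannot tell them apart.\<close>
    have "rel T0 (Ap (Ap (Ap Rr f) (Num m)) (Num n)) (Num w)"
      using w by (simp add: rel_T0)
    then have "rel T0 (Ap (Ap f (Num n)) (Ap (Ap (Ap Rr f) (Num m)) (Num n))) (Ap (Ap f (Num n)) (Num w))"
      by (rule rel_Ap[OF rel_Ap[OF f rel_Num]])
    then obtain v where v: "ev f [Num n, Ap (Ap (Ap Rr f) (Num m)) (Num n)] v" "ev f [Num n, Num w] v"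
      by (auto simp: rel_T0)
    have "ev Rr [f, Num m, Ap (Ap (Fn2 (+)) (Num n)) (Num 1)] v"
      by (rule ev_RrS[OF _ w v(2)]) simp
    then show ?thesis using v(1) by blast
  qed
  show ?thesis
    using assms(2) zero suc unfolding recursor_axioms_def
    by (auto simp: reading_simps sat_sall[of "T0 \<rightarrowtail> T0 \<rightarrowtail> T0"] assms(1))
qed

lemma sat_extensionality:
  assumes "env_rel e e" "A \<in> extensionality_axioms"
  shows "sat A e"
proof -
  obtain \<rho> \<tau> where A: "A = sentence (\<^bold>\<forall>x\<^bold>:\<rho>\<^bold>. \<^bold>\<forall>y\<^bold>:\<rho>\<^bold>. \<^bold>\<forall>f\<^bold>:\<rho> \<rightarrowtail> \<tau>\<^bold>. eqT \<rho> x y \<^bold>\<longrightarrow> eqT \<tau> (f \<cdot> x) (f \<cdot> y))"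
    using assms(2) unfolding extensionality_axioms_def by blast
  show ?thesis
    unfolding A by (simp add: sentence_def sat_sall sat_connectives sat_eqT env_rel_updI assms(1)) (blast intro: rel_Ap)
qed

lemma qf_free_for: "qf A \<Longrightarrow> free_for u x A"
  by (induction A) auto

lemma sat_qf_induction:
  assumes e: "env_rel e e" and "A \<in> qf_induction"
  shows "sat A e"
proof -
  obtain n B where A: "A = Imp (subst n Zero B) (Imp (All n (Imp B (subst n (Var n \<oplus> One) B))) (All n B))"
    and B: "snd n = T0" "qf B" "wff B"
    using assms(2) unfolding qf_induction_def by blast
  obtain i where n: "n = (i, T0)" using B(1) by (metis prod.collapse)
  have step: "sat (subst n (Var n \<oplus> One) B) (e(n := Num k)) = sat B (e(n := Num (Suc k)))" for k
    unfolding sat_subst[OF qf_free_for[OF B(2)]]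
    by (rule sat_env_rel[OF _ B(3)]) (use e B(1) in \<open>simp add: env_rel_def rel_T0 addt_def del: split_paired_All\<close>)
  have "sat (All n B) e \<longleftrightarrow> (\<forall>k. sat B (e(n := Num k)))"
    by (simp only: n sat_All_normal(1)[OF e B(3)])
  moreover have "wff (Imp B (subst n (Var n \<oplus> One) B))"
    using B by (simp add: wff_subst wt_arith)
  then have "sat (All n (Imp B (subst n (Var n \<oplus> One) B))) e \<longleftrightarrow>
      (\<forall>k. sat B (e(n := Num k)) \<longrightarrow> sat B (e(n := Num (Suc k))))"
    using step by (simp only: n sat_All_normal(1)[OF e] sat.simps(4))
  moreover have "sat (subst n Zero B) e \<longleftrightarrow> sat B (e(n := Num 0))"
    by (simp only: sat_subst[OF qf_free_for[OF B(2)]] tv.simps)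
  ultimately show ?thesis
    unfolding A sat.simps(4) using nat_induct[of "\<lambda>k. sat B (e(n := Num k))"] by blast
qed

lemma sat_QF_AC:
  assumes e: "env_rel e e" and "A \<in> QF_AC T1 T0"
  shows "sat A e"
proof -
  obtain x y Y B where A: "A = Imp (All x (Ex y B)) (Ex Y (All x (subst y (Var Y \<cdot> Var x) B)))"
    and B: "qf B" "wff B" and vars: "snd x = T1" "snd y = T0" "snd Y = T2" "x \<noteq> y" "Y \<notin> fv B"
    using assms(2) unfolding QF_AC_def by blast
  obtain i j k where x: "x = (i, T1)" and y: "y = (j, T0)" and Y: "Y = (k, T2)"
    using vars by (metis prod.collapse)
  \<comment> \<open>Taking the least witness makes the choice functional computable by
    \<open>OMu\<close> from quantifier-free truth.\<close>
  define F where "F f = (LEAST m. sat B (e(x := Fn1 f, y := Num m)))" for f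
  have "rel T2 (Gc1 F) (Gc1 F)"
  proof (rule rel_Gc1)
    fix g assume g: "g \<in> seqs"
    \<comment> \<open>The index \<open>n\<close> codes a row of \<open>g\<close> together with a
      candidate witness.\<close>
    let ?\<epsilon> = "\<lambda>n. e(x := Fn1 (row (fst (prod_decode n)) g), y := Num (snd (prod_decode n)))"
    have "env_plot ?\<epsilon> ?\<epsilon>"
      unfolding env_plot_def
    proof
      fix z
      consider "z = y" | "z = x" | "z \<noteq> x" "z \<noteq> y" by blast
      then show "plot (snd z) (\<lambda>n. ?\<epsilon> n z) (\<lambda>n. ?\<epsilon> n z)"
      proof cases
        case 1
        then show ?thesis using plot_Num[OF seqs_simple(4)] vars(2) by simp
      next
        case 2
        then show ?thesis
          using plot_reindex[OF plot_Fn1[OF g] seqs_simple(3)] vars(1,4) by (simp del: plot.simps)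
      next
        case 3
        then show ?thesis using e by (simp add: env_rel_def rel_def del: plot.simps split_paired_All)
      qed
    qed
    from seqs_least[OF seqs_sat_qf[OF this B]] show "(\<lambda>n. F (row n g)) \<in> seqs"
      by (simp add: F_def del: One_nat_def)
  qed
  then have eY: "env_rel (e(Y := Gc1 F)) (e(Y := Gc1 F))"
    using e vars(3) by (simp add: env_rel_updI)
  have "sat (All x (subst y (Var Y \<cdot> Var x) B)) (e(Y := Gc1 F))" if ex: "sat (All x (Ex y B)) e"
  proof -
    have "sat (subst y (Var Y \<cdot> Var x) B) (e(Y := Gc1 F, x := Fn1 f))" if f: "f \<in> seqs" for f
    proof -
      have ef: "env_rel (e(x := Fn1 f)) (e(x := Fn1 f))"
        using e f vars(1) by (simp add: env_rel_updI rel_Fn1)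
      have "sat (Ex y B) (e(x := Fn1 f))"
        using ex f vars(1) rel_Fn1 by simp
      then have "\<exists>m. sat B (e(x := Fn1 f, y := Num m))"
        using sat_All_normal(1)[OF ef, of "Neg B" j] B(2) by (simp add: y del: sat.simps(5))
      then have "sat B (e(x := Fn1 f, y := Num (F f)))"
        unfolding F_def by (rule LeastI_ex)
      also have "sat B (e(x := Fn1 f, y := Num (F f))) = sat B (e(Y := Gc1 F, x := Fn1 f, y := Num (F f)))"
        using vars(5) by (intro sat_cong) auto
      \<comment> \<open>The numeral and the application of \<open>Gc1 F\<close> are different codes
        with the same value.\<close>
      also have "\<dots> = sat B (e(Y := Gc1 F, x := Fn1 f, y := Ap (Gc1 F) (Fn1 f)))"
        using f vars(1,2) by (intro sat_env_rel[OF env_rel_upd[OF env_rel_upd[OF eY]] B(2)]) (simp_all add: rel_Fn1 rel_T0)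
      also have "\<dots> = sat (subst y (Var Y \<cdot> Var x) B) (e(Y := Gc1 F, x := Fn1 f))"
        using vars(1,3) by (subst sat_subst[OF qf_free_for[OF B(1)]]) auto
      finally show ?thesis .
    qed
    then show ?thesis
      using sat_All_normal(2)[OF eY, of "subst y (Var Y \<cdot> Var x) B" i] wff_subst[OF B(2)] vars
      by (simp add: x del: sat.simps(5))
  qed
  then show ?thesis
    unfolding A using \<open>rel T2 (Gc1 F) (Gc1 F)\<close> vars(3) by auto
qed

lemma sat_S2:
  assumes "env_rel e e"
  shows "sat (S2 k) e"
proof -
  let ?F = "\<lambda>f. if trS k f [] then 0 else 1 :: nat"
  have F: "rel T2 (Gc1 ?F) (Gc1 ?F)"
    by (rule rel_Gc1) (rule seqs_truth)
  have "sat (SigmaNF k (Var (1, T1)) [] 2) (e((0, T2) := Gc1 ?F, (1, T1) := Fn1 f)) \<longleftrightarrow> trS k f []" if "f \<in> seqs" for f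
    using that F by (subst sat_NF(1)[where \<gamma>s = "[]" and \<phi> = f]) (simp_all add: env_rel_updI assms rel_Fn1)
  then show ?thesis
    unfolding S2_def sentence_def sat_sex
    using F by (intro exI[of _ "Gc1 ?F"])
      (simp add: sat_quantifiers sat_connectives sat_atoms wff_connectives wff_NF env_rel_updI assms numeral_2_eq_2)
qed

lemma sat_IND0:
  assumes e: "env_rel e e"
  shows "sat IND0 e"
proof -
  let ?bin = "\<lambda>f. \<forall>n. f n = 0 \<or> f n = (1 :: nat)"
  have w: "\<exists>w. rel (T0 \<rightarrowtail> T1) w w \<and> (\<forall>m<k.
      ((\<forall>n. ev w [Num m, Num n] 0 \<or> ev w [Num m, Num n] 1) \<and> ev Y [Ap w (Num m), Num m] 0 \<longleftrightarrow>
      (\<exists>f. f \<in> seqs \<and> ?bin f \<and> ev Y [Fn1 f, Num m] 0)))"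
    if Y: "rel (T1 \<rightarrowtail> T0 \<rightarrowtail> T0) Y Y" for Y k
  proof -
    \<comment> \<open>Where no solution exists, any member of \<open>seqs\<close> serves: both sides
      of the required equivalence are then false.\<close>
    have "\<forall>m. \<exists>f. f \<in> seqs \<and> ((\<exists>f. f \<in> seqs \<and> ?bin f \<and> ev Y [Fn1 f, Num m] 0) \<longrightarrow>
      ?bin f \<and> ev Y [Fn1 f, Num m] 0)"
      using seqs_simple(1) by blast
    from choice[OF this] obtain f where "\<forall>m. f m \<in> seqs \<and> ((\<exists>f. f \<in> seqs \<and> ?bin f \<and> ev Y [Fn1 f, Num m] 0) \<longrightarrow>
      ?bin (f m) \<and> ev Y [Fn1 (f m), Num m] 0)" ..
    note f = spec[OF this]
    obtain h where h: "h \<in> seqs" "\<And>m. m < k \<Longrightarrow> row m h = f m"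
      using seqs_code_list[of "map f [0..<k]"] f by auto
    define w where "w = Fn2 (\<lambda>m n. h (prod_encode (m, n)))"
    have w: "rel (T0 \<rightarrowtail> T1) w w"
      unfolding rel_def w_def by (rule plot_Fn2[OF h(1)]) simp
    have "(\<forall>n. ev w [Num m, Num n] 0 \<or> ev w [Num m, Num n] 1) \<and> ev Y [Ap w (Num m), Num m] 0 \<longleftrightarrow>
      (\<exists>f. f \<in> seqs \<and> ?bin f \<and> ev Y [Fn1 f, Num m] 0)" if "m < k" for m
    proof -
      have hm: "h (prod_encode (m, n)) = f m n" for n
        using h(2)[OF that] by (metis row_def)
      \<comment> \<open>The section of \<open>w\<close> at \<open>m\<close> is another code for
        \<open>f m\<close>; as \<open>Y\<close> is extensional, it accepts both or neither.\<close>
      have "rel T1 (Fn1 (f m)) (Fn1 (f m))"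
        using f rel_Fn1 by blast
      then have "rel T1 (Fn1 (f m)) (Ap w (Num m))"
        by (rule rel_ext[OF _ rel_Ap[OF w rel_Num]]) (auto simp: rel_T0 w_def hm)
      from rel_Ap[OF rel_Ap[OF Y this] rel_Num, of m] have "ev Y [Ap w (Num m), Num m] 0 \<longleftrightarrow> ev Y [Fn1 (f m), Num m] 0"
        by (auto simp: rel_T0 dest: ev_det)
      moreover have "(\<forall>n. ev w [Num m, Num n] 0 \<or> ev w [Num m, Num n] 1) \<longleftrightarrow> ?bin (f m)"
        unfolding w_def by (auto simp: hm)
      ultimately have *: "(\<forall>n. ev w [Num m, Num n] 0 \<or> ev w [Num m, Num n] 1) \<and> ev Y [Ap w (Num m), Num m] 0 \<longleftrightarrow>
          ?bin (f m) \<and> ev Y [Fn1 (f m), Num m] 0"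
        by (simp only:)
      show ?thesis
        unfolding *
        by (rule iffI, intro exI[of _ "f m"] conjI, rule conjunct1[OF f], erule conjunct1, erule conjunct2,
            erule HOL.mp[OF conjunct2[OF f]])
    qed
    then show ?thesis using w by blast
  qed
  show ?thesis
    unfolding IND0_def sentence_def
    by (simp add: sat_sall[of "T1 \<rightarrowtail> T0 \<rightarrowtail> T0"] sat_sex[of "T0 \<rightarrowtail> T1"] binary_def reading_simps e
        wff_eqT cong: conj_cong) (use w in simp)
qed

section \<open>Real numbers in the model\<close>

lemma isr_bound:
  assumes "isr x"
  shows "\<bar>qv (x n) - rval x\<bar> \<le> 1 / 2 ^ n"
proof -
  have step: "\<bar>qv (x n) - qv (x (n + i))\<bar> < 1 / 2 ^ n" for n i
    using assms by (simp add: isr_def)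
  have "Cauchy (\<lambda>n. qv (x n))"
    unfolding Cauchy_def
  proof (intro allI impI)
    fix \<epsilon> :: real assume "\<epsilon> > 0"
    then obtain N where N: "1 / 2 ^ N < \<epsilon> / 2"
      using real_arch_pow_inv[of "\<epsilon> / 2" "1 / 2"] by (auto simp: power_one_over)
    have "dist (qv (x m)) (qv (x k)) < \<epsilon>" if "m \<ge> N" "k \<ge> N" for m k
      using step[of N "m - N"] step[of N "k - N"] that N by (simp add: dist_real_def)
    then show "\<exists>M. \<forall>m\<ge>M. \<forall>n\<ge>M. dist (qv (x m)) (qv (x n)) < \<epsilon>" by blast
  qed
  then have "(\<lambda>n. qv (x n)) \<longlonglongrightarrow> rval x"
    unfolding rval_def by (simp add: Cauchy_convergent convergent_LIMSEQ_iff[symmetric])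
  then have "(\<lambda>i. \<bar>qv (x n) - qv (x (i + n))\<bar>) \<longlonglongrightarrow> \<bar>qv (x n) - rval x\<bar>"
    by (intro tendsto_intros LIMSEQ_ignore_initial_segment)
  then show ?thesis
    by (rule LIMSEQ_le_const2) (use step[of n] in \<open>auto simp: add.commute less_imp_le\<close>)
qed

lemma small_power:
  assumes "0 < (\<epsilon> :: real)"
  obtains n where "c / 2 ^ n < \<epsilon>"
proof -
  obtain n where "(1 / 2 :: real) ^ n < \<epsilon> / (\<bar>c\<bar> + 1)"
    using real_arch_pow_inv[of "\<epsilon> / (\<bar>c\<bar> + 1)" "1 / 2"] assms by auto
  then have "(\<bar>c\<bar> + 1) / 2 ^ n < \<epsilon>"
    by (simp add: power_one_over field_simps)
  moreover have "c / 2 ^ n \<le> (\<bar>c\<bar> + 1) / 2 ^ n"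
    by (intro divide_right_mono) auto
  ultimately have "c / 2 ^ n < \<epsilon>" by linarith
  then show ?thesis by (rule that)
qed

lemma rval_eq:
  assumes "isr x" "isr y" "\<And>n. \<bar>qv (x n) - qv (y n)\<bar> \<le> 2 / 2 ^ n"
  shows "rval x = rval y"
proof (rule ccontr)
  assume "rval x \<noteq> rval y"
  \<comment> \<open>The sum of the two approximation errors and the assumed bound:
    \<open>1 + 2 + 1\<close>.\<close>
  then obtain n where "4 / 2 ^ n < \<bar>rval x - rval y\<bar>"
    using small_power[of "\<bar>rval x - rval y\<bar>" 4] by auto
  then show False
    using isr_bound[OF assms(1), of n] isr_bound[OF assms(2), of n] assms(3)[of n] by argo
qed

lemma rval_less_iff:
  assumes "isr x" "isr y"
  shows "rval x < rval y \<longleftrightarrow> (\<exists>n. 2 / 2 ^ n < qv (y n) - qv (x n))"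
proof
  assume "rval x < rval y"
  then obtain n where "4 / 2 ^ n < rval y - rval x"
    using small_power[of "rval y - rval x" 4] by auto
  then show "\<exists>n. 2 / 2 ^ n < qv (y n) - qv (x n)"
    using isr_bound[OF assms(1), of n] isr_bound[OF assms(2), of n] by (intro exI[of _ n]) argo
next
  assume "\<exists>n. 2 / 2 ^ n < qv (y n) - qv (x n)"
  then obtain n where "2 / 2 ^ n < qv (y n) - qv (x n)" ..
  then show "rval x < rval y"
    using isr_bound[OF assms(1), of n] isr_bound[OF assms(2), of n] by argo
qed

lemma rval_ball_iff:
  assumes "isr x" "isr y"
  shows "\<bar>rval x - rval y\<bar> < 1 / 2 ^ k \<longleftrightarrow>
    (\<exists>n. \<bar>qv (x (Suc n)) - qv (y (Suc n))\<bar> < 1 / 2 ^ k - 2 / 2 ^ n)"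
proof -
  have b: "\<bar>qv (x (Suc n)) - rval x\<bar> \<le> 1 / 2 * (1 / 2 ^ n)" "\<bar>qv (y (Suc n)) - rval y\<bar> \<le> 1 / 2 * (1 / 2 ^ n)"
    "0 < (1 :: real) / 2 ^ n" for n
    using isr_bound[OF assms(1), of "Suc n"] isr_bound[OF assms(2), of "Suc n"] by simp_all
  show ?thesis
  proof
    assume "\<bar>rval x - rval y\<bar> < 1 / 2 ^ k"
    \<comment> \<open>Replacing both reals by their approximations at \<open>Suc n\<close> costs
      \<open>1 / 2 ^ n\<close>, which leaves the required \<open>2 / 2 ^ n\<close>.\<close>
    then obtain n where "3 / 2 ^ n < 1 / 2 ^ k - \<bar>rval x - rval y\<bar>"
      using small_power[of "1 / 2 ^ k - \<bar>rval x - rval y\<bar>" 3] by auto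
    then show "\<exists>n. \<bar>qv (x (Suc n)) - qv (y (Suc n))\<bar> < 1 / 2 ^ k - 2 / 2 ^ n"
      using b[of n] by (intro exI[of _ n]) argo
  next
    assume "\<exists>n. \<bar>qv (x (Suc n)) - qv (y (Suc n))\<bar> < 1 / 2 ^ k - 2 / 2 ^ n"
    then obtain n where "\<bar>qv (x (Suc n)) - qv (y (Suc n))\<bar> < 1 / 2 ^ k - 2 / 2 ^ n" ..
    then show "\<bar>rval x - rval y\<bar> < 1 / 2 ^ k"
      using b[of n] by argo
  qed
qed

lemma constant_real:
  shows "isr (\<lambda>_. rcode a b c)" "rval (\<lambda>_. rcode a b c) = (real a - real b) / (real c + 1)"
  by (auto simp: isr_def rval_def qv_rcode)

section \<open>Denotations of rational and real terms\<close>

definition agree :: "nat \<Rightarrow> env \<Rightarrow> env \<Rightarrow> bool" where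
  "agree d e e' \<longleftrightarrow> (\<forall>x. fst x < d \<longrightarrow> e' x = e x)"

lemma tv_agree: "agree d e e' \<Longrightarrow> fresh d t \<Longrightarrow> tv e' t = tv e t"
  by (rule tv_cong) (auto simp: agree_def fresh_def)

fun wtq :: "rat_tm \<Rightarrow> bool" where
  "wtq (p, m, d) \<longleftrightarrow> (\<forall>t\<in>{p, m, d}. wt t \<and> type_of t = T0)"

text \<open>\<open>den e q r\<close>: the rational term \<open>q\<close> denotes \<open>r\<close> in \<open>e\<close>; \<open>xden\<close> and \<open>nden\<close> are analogous for sequences and numbers.\<close>

fun den :: "env \<Rightarrow> rat_tm \<Rightarrow> real \<Rightarrow> bool" where
  "den e (tp, tm, td) r \<longleftrightarrow> (\<exists>p m d. ev (tv e tp) [] p \<and> ev (tv e tm) [] m \<and> ev (tv e td) [] d \<and>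
     0 < d \<and> r = (real p - real m) / real d)"

lemma den_neg: "den e q r \<Longrightarrow> den e (rat_neg q) (- r)"
  by (cases q) (force simp: minus_divide_left)

lemma den_diff: "den e q r \<Longrightarrow> den e q' r' \<Longrightarrow> den e (rat_diff q q') (r - r')"
  by (cases q; cases q') (force simp: addt_def mult_def field_simps)

lemma sat_rat_less:
  assumes "den e q r" "den e q' r'"
  shows "sat (rat_less q q' k) e \<longleftrightarrow> r < r'"
proof -
  obtain tp tm td tp' tm' td' where q: "q = (tp, tm, td)" "q' = (tp', tm', td')"
    by (cases q; cases q')
  obtain p m d p' m' d' where ev: "ev (tv e tp) [] p" "ev (tv e tm) [] m" "ev (tv e td) [] d"
    "ev (tv e tp') [] p'" "ev (tv e tm') [] m'" "ev (tv e td') [] d'"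
    and d: "0 < d" "0 < d'" "r = (real p - real m) / real d" "r' = (real p' - real m') / real d'"
    using assms by (auto simp: q)
  have "sat (rat_less q q' k) e \<longleftrightarrow> p * d' + m' * d < p' * d + m * d'"
    using ev[THEN ev_unique] by (simp add: q sat_atoms addt_def mult_def)
  also have "\<dots> \<longleftrightarrow> real (p * d' + m' * d) < real (p' * d + m * d')"
    by linarith
  also have "\<dots> \<longleftrightarrow> r < r'"
  proof -
    have "r < r' \<longleftrightarrow> (real p - real m) * real d' < (real p' - real m') * real d"
      unfolding d(3,4) using d(1,2) by (simp add: pos_divide_less_eq pos_less_divide_eq)
    then show ?thesis by (simp add: algebra_simps)
  qed
  finally show ?thesis .
qed

lemma sat_rat_abs:
  assumes "den e q r" "den e q' r'"
  shows "sat (rat_abs_less q q' k) e \<longleftrightarrow> \<bar>r\<bar> < r'" "sat (rat_abs_le q q' k) e \<longleftrightarrow> \<bar>r\<bar> \<le> r'"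
  using sat_rat_less[OF assms] sat_rat_less[OF den_neg[OF assms(1)] assms(2)]
    sat_rat_less[OF assms(2,1)] sat_rat_less[OF assms(2) den_neg[OF assms(1)]]
  by (auto simp: rat_abs_less_def rat_abs_le_def sat_connectives)

lemma den_two_neg:
  assumes "tv e n = Num k"
  shows "den e (two_neg n) (1 / 2 ^ k)" "den e (two_neg1 n) (2 / 2 ^ k)"
  using assms by (simp_all add: two_neg_def two_neg1_def ev_Pow2 addt_def)

lemma wff_rat:
  "wtq q \<Longrightarrow> wtq (rat_neg q)" "wtq q \<Longrightarrow> wtq q' \<Longrightarrow> wtq (rat_diff q q')"
  "wt n \<Longrightarrow> type_of n = T0 \<Longrightarrow> wtq (two_neg n)" "wt n \<Longrightarrow> type_of n = T0 \<Longrightarrow> wtq (two_neg1 n)"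
  "wtq q \<Longrightarrow> wtq q' \<Longrightarrow> wff (rat_less q q' d)"
  by (cases q; cases q'; auto simp: two_neg_def two_neg1_def wt_arith wt_Pow2 wff_connectives)+

lemma wff_rat_abs:
  "wtq q \<Longrightarrow> wtq q' \<Longrightarrow> wff (rat_abs_less q q' d)" "wtq q \<Longrightarrow> wtq q' \<Longrightarrow> wff (rat_abs_le q q' d)"
  by (simp_all add: rat_abs_less_def rat_abs_le_def wff_connectives wff_rat)

definition xden :: "nat \<Rightarrow> env \<Rightarrow> tm \<Rightarrow> (nat \<Rightarrow> nat) \<Rightarrow> bool" where
  "xden d e x f \<longleftrightarrow> wt x \<and> type_of x = T1 \<and> fresh d x \<and> (\<forall>a m. ev a [] m \<longrightarrow> ev (tv e x) [a] (f m))"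

definition nden :: "nat \<Rightarrow> env \<Rightarrow> tm \<Rightarrow> nat \<Rightarrow> bool" where
  "nden d e n k \<longleftrightarrow> wt n \<and> type_of n = T0 \<and> fresh d n \<and> ev (tv e n) [] k"

definition coded :: "nat \<Rightarrow> bool" where
  "coded z \<longleftrightarrow> (\<exists>a b c. z = rcode a b c)"

lemma wff_approx:
  assumes "wt x" "type_of x = T1" "wt s" "type_of s = T0" "\<And>q d. wtq q \<Longrightarrow> wff (F q d)"
  shows "wff (approx x s F d)"
  using assms by (simp add: approx_def wff_connectives wt_arith rat_code_def)

text \<open>The rational is given by three bound variables. It has to keep its value in every
  environment that changes deeper variables only, since \<open>F\<close> may open further binders,
  as a nested \<open>approx\<close> does.\<close>

lemma sat_approx:
  assumes e: "env_rel e e" and x: "xden d e x f" and s: "nden d e s i"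
    and wff: "\<And>q d. wtq q \<Longrightarrow> wff (F q d)"
    and sat: "\<And>q r d' e1. agree d e e1 \<Longrightarrow> env_rel e1 e1 \<Longrightarrow> d \<le> d' \<Longrightarrow> wtq q \<Longrightarrow>
      (\<And>e2. agree d' e1 e2 \<Longrightarrow> den e2 q r) \<Longrightarrow> sat (F q d') e1 \<longleftrightarrow> P r"
  shows "sat (approx x s F d) e \<longleftrightarrow> coded (f i) \<and> P (qv (f i))"
proof -
  note fr = x[unfolded xden_def] s[unfolded nden_def]
  let ?v = "\<lambda>k. Var (k, T0)"
  let ?q = "(?v d, ?v (Suc d), ?v (Suc (Suc d)) \<oplus> One)"
  let ?e = "\<lambda>a b c. e((d, T0) := Num a, (Suc d, T0) := Num b, (Suc (Suc d), T0) := Num c)"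
  have body: "sat (F ?q (Suc (Suc (Suc d)))) (?e a b c) \<longleftrightarrow> P (qv (rcode a b c))" for a b c
  proof (rule sat)
    fix e2 assume "agree (Suc (Suc (Suc d))) (?e a b c) e2"
    then show "den e2 ?q (qv (rcode a b c))"
      by (simp add: agree_def addt_def qv_rcode)
  qed (simp_all add: agree_def env_rel_updI rel_Num e wt_arith)
  have upd: "tv (?e a b c) x = tv e x" "tv (?e a b c) s = tv e s" for a b c
    using fr by (simp_all add: tv_upd[of d])
  have ev: "ev (tv e x) [tv e s] v \<longleftrightarrow> v = f i" for v
    using fr by (meson ev_unique)
  have "sat ((x \<cdot> s \<^bold>= rat_code (?v d) (?v (Suc d)) (?v (Suc (Suc d)))) k) (?e a b c) \<longleftrightarrow> f i = rcode a b c" for a b c k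
    by (auto simp: sat_atoms upd ev rat_code_def pair_def addt_def mult_def rcode_def pairv_def)
  then have "sat (approx x s F d) e \<longleftrightarrow> (\<exists>a b c. f i = rcode a b c \<and> P (qv (rcode a b c)))"
    using fr wff body by (simp add: approx_def sat_quantifiers sat_connectives wff_connectives env_rel_updI rel_Num e
        wt_arith rat_code_def)
  then show ?thesis by (auto simp: coded_def)
qed

lemma agree_trans: "agree d e e1 \<Longrightarrow> agree d' e1 e2 \<Longrightarrow> d \<le> d' \<Longrightarrow> agree d e e2"
  by (auto simp: agree_def)

lemma fresh_mono: "fresh d t \<Longrightarrow> d \<le> d' \<Longrightarrow> fresh d' t"
  by (auto simp: fresh_def)

lemma xden_agree: "xden d e x f \<Longrightarrow> agree d e e1 \<Longrightarrow> d \<le> d' \<Longrightarrow> xden d' e1 x f"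
  by (auto simp: xden_def tv_agree fresh_mono)

lemma nden_agree: "nden d e n k \<Longrightarrow> agree d e e1 \<Longrightarrow> d \<le> d' \<Longrightarrow> nden d' e1 n k"
  by (auto simp: nden_def tv_agree fresh_mono)

lemma sat_approx2:
  assumes e: "env_rel e e" and x: "xden d e x f" and y: "xden d e y g"
    and s: "nden d e s i" and t: "nden d e t j"
    and wff: "\<And>q r d. wtq q \<Longrightarrow> wtq r \<Longrightarrow> wff (G q r d)"
    and sat: "\<And>q r a b d' e'. agree d e e' \<Longrightarrow> den e' q a \<Longrightarrow> den e' r b \<Longrightarrow> sat (G q r d') e' \<longleftrightarrow> P a b"
  shows "sat (approx x s (\<lambda>q. approx y t (G q)) d) e \<longleftrightarrow>
    coded (f i) \<and> coded (g j) \<and> P (qv (f i)) (qv (g j))"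
proof (rule sat_approx[OF e x s])
  fix q d' assume "wtq q"
  then show "wff (approx y t (G q) d')"
    using y t wff by (intro wff_approx) (auto simp: xden_def nden_def)
next
  fix q a d' e1
  assume *: "agree d e e1" "env_rel e1 e1" "d \<le> d'" "wtq q" "\<And>e2. agree d' e1 e2 \<Longrightarrow> den e2 q a"
  show "sat (approx y t (G q) d') e1 \<longleftrightarrow> coded (g j) \<and> P a (qv (g j))"
  proof (rule sat_approx[OF *(2) xden_agree[OF y *(1,3)] nden_agree[OF t *(1,3)]])
    fix r b d'' e2
    assume **: "agree d' e1 e2" "\<And>e3. agree d'' e2 e3 \<Longrightarrow> den e3 r b"
    show "sat (G q r d'') e2 \<longleftrightarrow> P a b"
      by (rule sat[OF agree_trans[OF *(1) **(1) *(3)] *(5)[OF **(1)] **(2)]) (simp add: agree_def)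
  qed (rule wff[OF *(4)])
qed

lemma xden_upd: "xden d e x f \<Longrightarrow> xden (Suc d) (e((d, \<sigma>) := a)) x f"
  by (rule xden_agree) (auto simp: agree_def)

lemma xden_var: "e (k, T1) = Fn1 f \<Longrightarrow> k < d \<Longrightarrow> xden d e (Var (k, T1)) f"
  by (auto simp: xden_def)

lemma xden_wt: "xden d e x f \<Longrightarrow> wt x" "xden d e x f \<Longrightarrow> type_of x = T1"
  by (simp_all add: xden_def)

lemma isr_coded: "isr f \<Longrightarrow> coded (f n)"
  by (simp add: isr_def coded_def)

lemma sat_is_real:
  assumes e: "env_rel e e" and x: "xden d e x f"
  shows "sat (is_real x d) e \<longleftrightarrow> isr f"
proof -
  let ?n = "Var (d, T0)" and ?i = "Var (Suc d, T0)"
  have inner: "sat (approx x ?n (\<lambda>q. approx x (?n \<oplus> ?i) (\<lambda>r. rat_abs_less (rat_diff q r) (two_neg ?n))) (Suc (Suc d)))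
      (e((d, T0) := Num n, (Suc d, T0) := Num i)) \<longleftrightarrow>
      coded (f n) \<and> coded (f (n + i)) \<and> \<bar>qv (f n) - qv (f (n + i))\<bar> < 1 / 2 ^ n" for n i
  proof (rule sat_approx2[where e = "e((d, T0) := Num n, (Suc d, T0) := Num i)" and f = f and g = f])
    fix q r a b d' e'
    assume *: "agree (Suc (Suc d)) (e((d, T0) := Num n, (Suc d, T0) := Num i)) e'" "den e' q a" "den e' r b"
    then show "sat (rat_abs_less (rat_diff q r) (two_neg ?n) d') e' \<longleftrightarrow> \<bar>a - b\<bar> < 1 / 2 ^ n"
      by (intro sat_rat_abs den_diff den_two_neg) (simp_all add: agree_def)
  qed (use x in \<open>simp_all add: xden_upd nden_def wt_arith addt_def env_rel_updI e rel_Num wff_rat wff_rat_abs\<close>)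
  have "wff (approx x ?n (\<lambda>q. approx x (?n \<oplus> ?i) (\<lambda>r. rat_abs_less (rat_diff q r) (two_neg ?n))) (Suc (Suc d)))"
    using xden_wt[OF x] by (intro wff_approx) (simp_all add: wt_arith wff_rat wff_rat_abs)
  then show ?thesis
    by (simp add: is_real_def sat_quantifiers wff_connectives env_rel_updI rel_Num e inner)
      (auto simp: isr_def coded_def)
qed

lemma sat_real_eq:
  assumes e: "env_rel e e" and x: "xden d e x f" and y: "xden d e y g" and real: "isr f" "isr g"
    and eq: "sat (real_eq x y d) e"
  shows "rval f = rval g"
proof -
  let ?n = "Var (d, T0)"
  have inner: "sat (approx x ?n (\<lambda>q. approx y ?n (\<lambda>r. rat_abs_le (rat_diff q r) (two_neg1 ?n))) (Suc d))
      (e((d, T0) := Num n)) \<longleftrightarrow>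
      coded (f n) \<and> coded (g n) \<and> \<bar>qv (f n) - qv (g n)\<bar> \<le> 2 / 2 ^ n" for n
  proof (rule sat_approx2[where e = "e((d, T0) := Num n)" and f = f and g = g])
    fix q r a b d' e'
    assume *: "agree (Suc d) (e((d, T0) := Num n)) e'" "den e' q a" "den e' r b"
    then show "sat (rat_abs_le (rat_diff q r) (two_neg1 ?n) d') e' \<longleftrightarrow> \<bar>a - b\<bar> \<le> 2 / 2 ^ n"
      by (intro sat_rat_abs den_diff den_two_neg) (simp_all add: agree_def)
  qed (use x y in \<open>simp_all add: xden_upd nden_def env_rel_updI e rel_Num wff_rat wff_rat_abs\<close>)
  have "wff (approx x ?n (\<lambda>q. approx y ?n (\<lambda>r. rat_abs_le (rat_diff q r) (two_neg1 ?n))) (Suc d))"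
    using xden_wt[OF x] xden_wt[OF y] by (intro wff_approx) (simp_all add: wff_rat wff_rat_abs)
  then show ?thesis
    using eq by (intro rval_eq real) (simp add: real_eq_def sat_quantifiers e inner)
qed

lemma sat_real_le:
  assumes e: "env_rel e e" and x: "xden d e x f" and y: "xden d e y g" and real: "isr f" "isr g"
  shows "sat (real_le x y d) e \<longleftrightarrow> rval f \<le> rval g"
proof -
  let ?n = "Var (d, T0)"
  have inner: "sat (approx y ?n (\<lambda>q. approx x ?n (\<lambda>r. rat_less (two_neg1 ?n) (rat_diff r q))) (Suc d))
      (e((d, T0) := Num n)) \<longleftrightarrow>
      coded (g n) \<and> coded (f n) \<and> 2 / 2 ^ n < qv (f n) - qv (g n)" for n
  proof (rule sat_approx2[where e = "e((d, T0) := Num n)" and f = g and g = f])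
    fix q r a b d' e'
    assume *: "agree (Suc d) (e((d, T0) := Num n)) e'" "den e' q a" "den e' r b"
    then show "sat (rat_less (two_neg1 ?n) (rat_diff r q) d') e' \<longleftrightarrow> 2 / 2 ^ n < b - a"
      by (intro sat_rat_less den_diff den_two_neg) (simp_all add: agree_def)
  qed (use x y in \<open>simp_all add: xden_upd nden_def env_rel_updI e rel_Num wff_rat\<close>)
  have "wff (approx y ?n (\<lambda>q. approx x ?n (\<lambda>r. rat_less (two_neg1 ?n) (rat_diff r q))) (Suc d))"
    using xden_wt[OF x] xden_wt[OF y] by (intro wff_approx) (simp_all add: wff_rat)
  then have "sat (real_less y x d) e \<longleftrightarrow> rval g < rval f"
    using rval_less_iff[OF real(2,1)] by (simp add: real_less_def sat_quantifiers e inner isr_coded real)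
  then show ?thesis
    by (auto simp: real_le_def sat_connectives)
qed

lemma sat_in_ball:
  assumes e: "env_rel e e" and x: "xden d e x f" and y: "xden d e y g" and real: "isr f" "isr g"
    and k: "e (j, T0) = Num k" "j < d"
  shows "sat (in_ball y x (Var (j, T0)) d) e \<longleftrightarrow> \<bar>rval f - rval g\<bar> < 1 / 2 ^ k"
proof -
  let ?n = "Var (d, T0)"
  let ?G = "\<lambda>q r. rat_abs_less (rat_diff q r) (rat_diff (two_neg (Var (j, T0))) (two_neg1 ?n))"
  have inner: "sat (approx x (?n \<oplus> One) (\<lambda>q. approx y (?n \<oplus> One) (?G q)) (Suc d)) (e((d, T0) := Num n)) \<longleftrightarrow>
      coded (f (n + 1)) \<and> coded (g (n + 1)) \<and> \<bar>qv (f (n + 1)) - qv (g (n + 1))\<bar> < 1 / 2 ^ k - 2 / 2 ^ n" for n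
  proof (rule sat_approx2[where e = "e((d, T0) := Num n)" and f = f and g = g])
    fix q r a b d' e'
    assume *: "agree (Suc d) (e((d, T0) := Num n)) e'" "den e' q a" "den e' r b"
    then show "sat (?G q r d') e' \<longleftrightarrow> \<bar>a - b\<bar> < 1 / 2 ^ k - 2 / 2 ^ n"
      using k by (intro sat_rat_abs den_diff den_two_neg) (simp_all add: agree_def)
  qed (use x y in \<open>simp_all add: xden_upd nden_def wt_arith addt_def env_rel_updI e rel_Num wff_rat wff_rat_abs\<close>)
  have "wff (approx x (?n \<oplus> One) (\<lambda>q. approx y (?n \<oplus> One) (?G q)) (Suc d))"
    using xden_wt[OF x] xden_wt[OF y] by (intro wff_approx) (simp_all add: wt_arith wff_rat wff_rat_abs)
  then show ?thesis
    using rval_ball_iff[OF real, of k] by (simp add: in_ball_def sat_quantifiers e inner isr_coded real)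
qed

lemma xden_constants: "xden d e real0 (\<lambda>_. rcode 0 0 0)" "xden d e real1 (\<lambda>_. rcode 1 0 0)"
  by (simp_all add: xden_def real0_def real1_def rat_code_def wt_arith pair_def addt_def mult_def rcode_def pairv_def)

lemma sat_unit_interval:
  assumes "env_rel e e" "xden d e x f"
  shows "sat (unit_interval x d) e \<longleftrightarrow> unitr f"
  using sat_is_real[OF assms] sat_real_le[OF assms(1) xden_constants(1) assms(2) constant_real(1)]
    sat_real_le[OF assms(1,2) xden_constants(2) _ constant_real(1)]
  by (auto simp: unit_interval_def sat_connectives unitr_def constant_real(2))

section \<open>A decreasing sequence of dense open sets with empty intersection\<close>

definition meager_seq :: "(nat \<Rightarrow> nat) \<Rightarrow> nat \<Rightarrow> nat" where
  "meager_seq x n = of_bool (n < rank x)"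

text \<open>This is where the stratification pays off: \<open>seqs_rank\<close> supplies the closure
  condition of \<open>rel_Gc2\<close>.\<close>

lemma rel_meager_seq: "rel (T1 \<rightarrowtail> T0 \<rightarrowtail> T0) (Gc2 meager_seq) (Gc2 meager_seq)"
proof (rule rel_Gc2)
  fix g r f assume *: "g \<in> seqs" "r \<in> seqs" "f \<in> seqs"
  show "(\<lambda>n. meager_seq (row (r n) g) (f n)) \<in> seqs"
    unfolding meager_seq_def using seqs_binary(5)[OF *(3) seqs_comp[OF seqs_rank[OF *(1)] *(2)]] .
qed

lemma finite_avoid:
  fixes a :: real
  shows "finite V \<Longrightarrow> \<exists>\<epsilon>>0. \<forall>v\<in>V. v \<noteq> a \<longrightarrow> \<epsilon> \<le> \<bar>a - v\<bar>"
proof (induction V rule: finite_induct)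
  case empty
  then show ?case using zero_less_one by blast
next
  case (insert v V)
  then obtain \<epsilon> where \<epsilon>: "\<epsilon> > 0" "\<forall>v\<in>V. v \<noteq> a \<longrightarrow> \<epsilon> \<le> \<bar>a - v\<bar>" by blast
  show ?case
    by (rule exI[of _ "if v = a then \<epsilon> else min \<epsilon> \<bar>a - v\<bar>"]) (use \<epsilon> in auto)
qed

text \<open>The finitely many reals of rank at most \<open>n\<close> do not include that of
  \<open>x\<close>, by \<open>rank_cong\<close>, hence they keep a positive distance from
  it.\<close>

lemma rank_open:
  assumes x: "unitr x" "n < rank x"
  shows "\<exists>k. \<forall>y. y \<in> seqs \<longrightarrow> unitr y \<longrightarrow> \<bar>rval x - rval y\<bar> < 1 / 2 ^ k \<longrightarrow> n < rank y"
proof -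
  obtain \<epsilon> where \<epsilon>: "\<epsilon> > 0" "\<forall>v\<in>rval ` {y \<in> seqs. unitr y \<and> rank y \<le> n}. v \<noteq> rval x \<longrightarrow> \<epsilon> \<le> \<bar>rval x - v\<bar>"
    using finite_avoid[OF finite_rank_le[of n], of "rval x"] by blast
  obtain k where k: "1 / 2 ^ k < \<epsilon>"
    using small_power[OF \<epsilon>(1), of 1] .
  have "n < rank y" if y: "y \<in> seqs" "unitr y" "\<bar>rval x - rval y\<bar> < 1 / 2 ^ k" for y
  proof (rule ccontr)
    assume "\<not> n < rank y"
    then have "rval y \<in> rval ` {y \<in> seqs. unitr y \<and> rank y \<le> n}"
      using y by auto
    moreover have "rval y \<noteq> rval x"
      using rank_cong[OF y(2) x(1)] x(2) \<open>\<not> n < rank y\<close> by auto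
    ultimately have "\<epsilon> \<le> \<bar>rval x - rval y\<bar>" using \<epsilon>(2) by blast
    then show False using y(3) k by linarith
  qed
  then show ?thesis by blast
qed

text \<open>A rational in the ball can dodge the finitely many reals of rank at most
  \<open>n\<close>, and a rational has a constant representation, which lies in
  \<open>seqs\<close>.\<close>

lemma rank_dense:
  assumes x: "unitr x"
  shows "\<exists>y. y \<in> seqs \<and> unitr y \<and> \<bar>rval x - rval y\<bar> < 1 / 2 ^ k \<and> n < rank y"
proof -
  define W where "W = rval ` {y \<in> seqs. unitr y \<and> rank y \<le> n}"
  define l where "l = max 0 (rval x - 1 / 2 ^ k)"
  define u where "u = min 1 (rval x + 1 / 2 ^ k)"
  have pos: "0 < (1 :: real) / 2 ^ k" by simp
  have "l < u"
    using x pos unfolding l_def u_def unitr_def by linarith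
  \<comment> \<open>No element of \<open>W\<close> lies strictly between \<open>l'\<close> and
    \<open>u\<close>.\<close>
  define l' where "l' = Max (insert l (W \<inter> {..<u}))"
  have fin: "finite (insert l (W \<inter> {..<u}))"
    unfolding W_def using finite_rank_le by simp
  have "l' < u" "l \<le> l'"
    unfolding l'_def using fin \<open>l < u\<close> by auto
  then obtain q where q: "q \<in> \<rat>" "l' < q" "q < u"
    using Rats_dense_in_real by blast
  then have "0 < q" using \<open>l \<le> l'\<close> by (simp add: l_def)
  obtain m d where d: "d \<noteq> 0" "q = real m / real d"
    using Rats_abs_nat_div_natE[OF q(1)] \<open>0 < q\<close> by (metis abs_of_pos)
  \<comment> \<open>The subtrahend is 0 because \<open>q\<close> is positive, and
    \<open>d - 1\<close> compensates for the 1 that the coding adds to the denominator.\<close>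
  let ?y = "\<lambda>_ :: nat. rcode m 0 (d - 1)"
  have val: "rval ?y = q"
    using d by (simp add: constant_real(2) of_nat_diff)
  have y: "?y \<in> seqs" "unitr ?y"
    using seqs_simple(2) constant_real(1) val q \<open>0 < q\<close> by (auto simp: unitr_def u_def)
  have "n < rank ?y"
  proof (rule ccontr)
    assume "\<not> n < rank ?y"
    then have "rval ?y \<in> W"
      unfolding W_def using y by (intro imageI) simp
    then have "q \<le> l'"
      unfolding l'_def using fin q(3) val by (intro Max_ge) auto
    then show False using q(2) by simp
  qed
  moreover have "\<bar>rval x - rval ?y\<bar> < 1 / 2 ^ k"
    using q \<open>l \<le> l'\<close> unfolding val l_def u_def by linarith
  ultimately show ?thesis using y by blast
qed

text \<open>With these projections the next two lemmas are rewrite rules without extra variables.\<close>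

definition fn_of :: "cm \<Rightarrow> nat \<Rightarrow> nat" where
  "fn_of c = (case c of Fn1 f \<Rightarrow> f | _ \<Rightarrow> (\<lambda>_. 0))"

definition num_of :: "cm \<Rightarrow> nat" where
  "num_of c = (case c of Num n \<Rightarrow> n | _ \<Rightarrow> 0)"

lemma fn_of_simps [simp]: "fn_of (Fn1 f) = f" "num_of (Num n) = n"
  by (simp_all add: fn_of_def num_of_def)

lemma sat_real_vars:
  assumes "env_rel e e" "e (i, T1) = Fn1 (fn_of (e (i, T1)))" "i < d"
  shows "sat (is_real (Var (i, T1)) d) e \<longleftrightarrow> isr (fn_of (e (i, T1)))"
    "sat (unit_interval (Var (i, T1)) d) e \<longleftrightarrow> unitr (fn_of (e (i, T1)))"
  using sat_is_real[OF assms(1) xden_var[of e, OF assms(2,3)]] sat_unit_interval[OF assms(1) xden_var[of e, OF assms(2,3)]] .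

lemma sat_ball_vars:
  assumes "env_rel e e" "e (i, T1) = Fn1 (fn_of (e (i, T1)))" "i < d"
    "e (j, T1) = Fn1 (fn_of (e (j, T1)))" "j < d" "e (k, T0) = Num (num_of (e (k, T0)))" "k < d"
    "isr (fn_of (e (i, T1)))" "isr (fn_of (e (j, T1)))"
  shows "sat (in_ball (Var (j, T1)) (Var (i, T1)) (Var (k, T0)) d) e \<longleftrightarrow>
    \<bar>rval (fn_of (e (i, T1))) - rval (fn_of (e (j, T1)))\<bar> < 1 / 2 ^ num_of (e (k, T0))"
  using sat_in_ball[OF assms(1) xden_var[of e, OF assms(2,3)] xden_var[of e, OF assms(4,5)] assms(8,9,6,7)] .

lemma not_sat_BCT01:
  assumes e: "env_rel e e"
  shows "\<not> sat BCT01 e"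
proof
  assume BCT: "sat BCT01 e"
  let ?T = "T1 \<rightarrowtail> T0 \<rightarrowtail> T0"
  let ?U = "Var (0, ?T)"
  define e1 where "e1 = e((0, ?T) := Gc2 meager_seq)"
  have e1: "env_rel e1 e1" "e1 (0, ?T) = Gc2 meager_seq"
    using e rel_meager_seq by (simp_all add: e1_def env_rel_updI)
  note simps = sat_connectives sat_quantifiers wff_connectives wff_is_real wff_reals wff_unit_interval wff_in_ball
    wt_arith env_rel_updI rel_Num rel_Fn1 e1 mem_def sat_real_vars sat_atoms
  have eq: "rank f = rank g"
    if "isr f" "isr g" "f \<in> seqs" "g \<in> seqs"
      "sat (real_eq (Var (2, T1)) (Var (3, T1)) 4) (e1((1, T0) := Num n, (2, T1) := Fn1 f, (3, T1) := Fn1 g))" for n f g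
  proof -
    have "rval f = rval g"
      by (rule sat_real_eq[OF _ _ _ that(1,2,5)])
        (simp_all add: env_rel_updI e1 rel_Num rel_Fn1 that xden_def, blast+)
    then show ?thesis
      using that(1,2) by (simp add: rank_def idxf_def unitr_def)
  qed
  have "sat (set_seq ?U 1) e1"
    unfolding set_seq_def using eq
    by (simp add: simps numeral_eq_Suc cong: imp_cong) (auto simp: meager_seq_def)
  moreover have "sat ((\<^bold>\<forall>n\<^bold>:T0\<^bold>. within_unit ?U n \<^bold>\<and> open_unit ?U n \<^bold>\<and> dense_unit ?U n) 1) e1"
  proof -
    have mem: "meager_seq f n = Suc 0 \<longleftrightarrow> n < rank f" for f n
      by (simp add: meager_seq_def)
    \<comment> \<open>Outside the unit interval \<open>rank\<close> is 0, so no \<open>n\<close>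
      lies below it.\<close>
    have within: "0 \<le> rval f \<and> rval f \<le> 1" if "n < rank f" for f n
      using that by (auto simp: rank_def unitr_def split: if_splits)
    show ?thesis
      unfolding within_unit_def open_unit_def dense_unit_def
      by (simp add: simps sat_ball_vars unitr_def mem cong: conj_cong)
        (use within rank_open[unfolded unitr_def] rank_dense[unfolded unitr_def] in \<open>simp add: conj_assoc imp_conjL\<close>)
  qed
  moreover have "sat (decreasing_unit ?U 1) e1"
  proof -
    \<comment> \<open>The index \<open>n + 1\<close> is a term that still has to be evaluated, so
      the rule for numerals does not apply.\<close>
    have "ev (Gc2 meager_seq) [Fn1 f, Ap (Ap (Fn2 (+)) (Num n)) (Num 1)] v \<longleftrightarrow> v = meager_seq f (n + 1)" for f n v
      by (rule ev_unique[OF ev_Gc(2)]) simp_all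
    then show ?thesis
      unfolding decreasing_unit_def by (simp add: simps addt_def) (simp add: meager_seq_def)
  qed
  \<comment> \<open>Each \<open>x\<close> is missing from the set with index
    \<open>rank x\<close>.\<close>
  moreover have "\<not> sat ((\<^bold>\<exists>x\<^bold>:T1\<^bold>. unit_interval x \<^bold>\<and> (\<^bold>\<forall>n\<^bold>:T0\<^bold>. mem x ?U n)) 1) e1"
    by (simp add: simps meager_seq_def cong: conj_cong) auto
  moreover have "sat ((set_seq ?U \<^bold>\<and> (\<^bold>\<forall>n\<^bold>:T0\<^bold>. within_unit ?U n \<^bold>\<and> open_unit ?U n \<^bold>\<and> dense_unit ?U n) \<^bold>\<and>
      decreasing_unit ?U \<^bold>\<longrightarrow> (\<^bold>\<exists>x\<^bold>:T1\<^bold>. unit_interval x \<^bold>\<and> (\<^bold>\<forall>n\<^bold>:T0\<^bold>. mem x ?U n))) 1) e1"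
    using BCT rel_meager_seq by (simp add: BCT01_def sentence_def sat_sall[of ?T] e1_def)
  ultimately show False
    unfolding sat_connectives by blast
qed

theorem theorem2p2:
  shows "\<not> (Z2\<omega> \<union> {IND0} \<turnstile> BCT01)"
proof
  assume provable: "Z2\<omega> \<union> {IND0} \<turnstile> BCT01"
  have axioms: "sat A e" if "A \<in> Z2\<omega> \<union> {IND0}" "env_rel e e" for A e
    using that sat_semiring sat_combinator sat_recursor sat_extensionality sat_qf_induction sat_QF_AC sat_S2 sat_IND0
    unfolding Z2\<omega>_def RCA0\<omega>_def by blast
  \<comment> \<open>Soundness speaks about a given environment; one exists because every type is
    inhabited.\<close>
  have "env_rel (\<lambda>x. default (snd x)) (\<lambda>x. default (snd x))"
    by (simp add: env_rel_def rel_default)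
  with soundness[OF provable axioms] not_sat_BCT01 show False
    by blast
qed

end
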